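(* The noncommutative extreme points of the noncommutative square $[-1,1]^2_{\mathrm{nc}}$ occur at levels $1$ and $2$ of the grading (that is, at these levels and at no other levels $n\in\mathbb N\cup\{\aleph_0\}$).
   Context: $[-1,1]^2_{\mathrm{nc}}=\bigsqcup_{n\le\aleph_0}[-1,1]^2_n$, where for $n\in\mathbb N\cup\{\aleph_0\}$, $[-1,1]^2_n$ is the set of pairs $(a_1,a_2)$ of selfadjoint operators in $\mathcal B(\ell^2(n))$ with $\|a_1\|,\|a_2\|\le1$; it is a noncommutative convex set (a graded set closed under direct sums and compressions by isometries). Let $K_{\mathrm{nc}}=\bigsqcup_{n\le\aleph_0}K_n$ be a noncommutative convex set. An element $x\in K_n$ is pure if, whenever $x=\sum_j\gamma_j^*x_j\gamma_j$ with $x_j\in K_{n_j}$ and $\{\gamma_j\}_j$ a bounded family of nonzero operators $\gamma_j:\ell^2(n)\to\ell^2(n_j)$ with $\sum_j\gamma_j^*\gamma_j=1$, each $\gamma_j$ is a scalar multiple of an isometry $\nu_j$ and $\nu_j^*x_j\nu_j=x$. An element $x\in K_n$ is maximal if the only elements of $K_{\mathrm{nc}}$ of the form $\begin{bmatrix} x & z_{12} \\ z_{21} & z_{22} \end{bmatrix}$ are those with $z_{12}=0$, $z_{21}=0$ and $z_{22}\in K_{\mathrm{nc}}$. (For tuples, all operations are applied coordinatewise.) A noncommutative extreme point is an element that is both pure and maximal. *)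

theory Defs
  imports "HOL-Analysis.Analysis" "HOL-Library.Extended_Nat"
begin

typedef ell2 = "{x :: nat \<Rightarrow> complex. summable (\<lambda>k. (cmod (x k))\<^sup>2)}"
  morphisms coord Abs_ell2
  by (rule exI[of _ "\<lambda>_. 0"]) simp

setup_lifting type_definition_ell2

lemma ell2_summable_mult:
  fixes x y :: "nat \<Rightarrow> complex"
  assumes "summable (\<lambda>k. (cmod (x k))\<^sup>2)" "summable (\<lambda>k. (cmod (y k))\<^sup>2)"
  shows "summable (\<lambda>k. cmod (x k) * cmod (y k))"
proof (rule summable_comparison_test')
  show "summable (\<lambda>k. (cmod (x k))\<^sup>2 + (cmod (y k))\<^sup>2)"
    using assms by (rule summable_add)
  show "norm (cmod (x k) * cmod (y k)) \<le> (cmod (x k))\<^sup>2 + (cmod (y k))\<^sup>2" if "0 \<le> k" for k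
  proof -
    have "2 * cmod (x k) * cmod (y k) \<le> (cmod (x k))\<^sup>2 + (cmod (y k))\<^sup>2"
      by (rule sum_squares_bound)
    moreover have "0 \<le> cmod (x k) * cmod (y k)"
      by simp
    ultimately show ?thesis by (simp only: real_norm_def abs_of_nonneg)
  qed
qed

lemma ell2_summable_add:
  fixes x y :: "nat \<Rightarrow> complex"
  assumes "summable (\<lambda>k. (cmod (x k))\<^sup>2)" "summable (\<lambda>k. (cmod (y k))\<^sup>2)"
  shows "summable (\<lambda>k. (cmod (x k + y k))\<^sup>2)"
proof (rule summable_comparison_test')
  show "summable (\<lambda>k. (cmod (x k))\<^sup>2 + (cmod (y k))\<^sup>2 + 2 * (cmod (x k) * cmod (y k)))"
    by (intro summable_add summable_mult assms ell2_summable_mult)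
  show "norm ((cmod (x k + y k))\<^sup>2)
      \<le> (cmod (x k))\<^sup>2 + (cmod (y k))\<^sup>2 + 2 * (cmod (x k) * cmod (y k))" if "0 \<le> k" for k
  proof -
    have "(cmod (x k + y k))\<^sup>2 \<le> (cmod (x k) + cmod (y k))\<^sup>2"
      by (rule power_mono[OF norm_triangle_ineq]) simp
    then show ?thesis by (simp add: power2_sum)
  qed
qed

lemma ell2_summable_inner:
  fixes x y :: "nat \<Rightarrow> complex"
  assumes "summable (\<lambda>k. (cmod (x k))\<^sup>2)" "summable (\<lambda>k. (cmod (y k))\<^sup>2)"
  shows "summable (\<lambda>k. x k \<bullet> y k)"
  by (rule summable_comparison_test'[OF ell2_summable_mult[OF assms]])
     (simp add: Cauchy_Schwarz_ineq2)

instantiation ell2 :: real_vector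
begin

lift_definition zero_ell2 :: ell2 is "\<lambda>_. 0" by simp

lift_definition plus_ell2 :: "ell2 \<Rightarrow> ell2 \<Rightarrow> ell2" is "\<lambda>x y k. x k + y k"
  by (rule ell2_summable_add)

lift_definition uminus_ell2 :: "ell2 \<Rightarrow> ell2" is "\<lambda>x k. - x k" by simp

definition minus_ell2 :: "ell2 \<Rightarrow> ell2 \<Rightarrow> ell2" where "minus_ell2 x y = x + - y"

lift_definition scaleR_ell2 :: "real \<Rightarrow> ell2 \<Rightarrow> ell2" is "\<lambda>r x k. r *\<^sub>R x k"
  by (simp add: power_mult_distrib summable_mult)

instance
proof
  fix x y z :: ell2 and r s :: real
  show "x + y + z = x + (y + z)" by transfer (simp add: add.assoc)
  show "x + y = y + x" by transfer (simp add: add.commute)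
  show "0 + x = x" by transfer simp
  show "- x + x = 0" by transfer simp
  show "x - y = x + - y" by (rule minus_ell2_def)
  show "r *\<^sub>R (x + y) = r *\<^sub>R x + r *\<^sub>R y" by transfer (simp add: scaleR_add_right)
  show "(r + s) *\<^sub>R x = r *\<^sub>R x + s *\<^sub>R x" by transfer (simp add: scaleR_add_left)
  show "r *\<^sub>R s *\<^sub>R x = (r * s) *\<^sub>R x" by transfer simp
  show "1 *\<^sub>R x = x" by transfer simp
qed

end

instantiation ell2 :: real_inner
begin

definition inner_ell2 :: "ell2 \<Rightarrow> ell2 \<Rightarrow> real"
  where "inner_ell2 x y = (\<Sum>k. coord x k \<bullet> coord y k)"

definition norm_ell2 :: "ell2 \<Rightarrow> real"
  where "norm_ell2 x = sqrt (\<Sum>k. (cmod (coord x k))\<^sup>2)"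

definition dist_ell2 :: "ell2 \<Rightarrow> ell2 \<Rightarrow> real" where "dist_ell2 x y = norm (x - y)"

definition sgn_ell2 :: "ell2 \<Rightarrow> ell2" where "sgn_ell2 x = x /\<^sub>R norm x"

definition uniformity_ell2 :: "(ell2 \<times> ell2) filter"
  where "uniformity_ell2 = (INF e\<in>{0<..}. principal {(x, y). dist x y < e})"

definition open_ell2 :: "ell2 set \<Rightarrow> bool"
  where "open_ell2 U \<longleftrightarrow> (\<forall>x\<in>U. \<forall>\<^sub>F (x', y) in uniformity. x' = x \<longrightarrow> y \<in> U)"

instance
proof
  fix x y z :: ell2 and r :: real and U :: "ell2 set"
  have sx: "summable (\<lambda>k. (cmod (coord w k))\<^sup>2)" for w
    using coord[of w] by simp
  show "dist x y = norm (x - y)" by (rule dist_ell2_def)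
  show "sgn x = x /\<^sub>R norm x" by (rule sgn_ell2_def)
  show "uniformity = (INF e\<in>{0<..}. principal {(x :: ell2, y). dist x y < e})"
    by (rule uniformity_ell2_def)
  show "open U \<longleftrightarrow> (\<forall>x\<in>U. \<forall>\<^sub>F (x', y) in uniformity. x' = x \<longrightarrow> y \<in> U)"
    by (rule open_ell2_def)
  show "x \<bullet> y = y \<bullet> x" by (simp add: inner_ell2_def inner_commute)
  show "(x + y) \<bullet> z = x \<bullet> z + y \<bullet> z"
    by (simp add: inner_ell2_def plus_ell2.rep_eq inner_add_left suminf_add
        ell2_summable_inner sx)
  show "(r *\<^sub>R x) \<bullet> y = r * (x \<bullet> y)"
    by (simp add: inner_ell2_def scaleR_ell2.rep_eq suminf_mult ell2_summable_inner sx)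
  have xx: "x \<bullet> x = (\<Sum>k. (cmod (coord x k))\<^sup>2)"
    by (simp add: inner_ell2_def power2_norm_eq_inner)
  show "0 \<le> x \<bullet> x" unfolding xx by (rule suminf_nonneg[OF sx]) simp
  show "x \<bullet> x = 0 \<longleftrightarrow> x = 0"
  proof -
    have "x \<bullet> x = 0 \<longleftrightarrow> (\<forall>k. (cmod (coord x k))\<^sup>2 = 0)"
      unfolding xx by (rule suminf_eq_zero_iff[OF sx]) simp
    then show ?thesis by (simp add: coord_inject[symmetric] zero_ell2.rep_eq fun_eq_iff)
  qed
  show "norm x = sqrt (x \<bullet> x)" by (simp add: norm_ell2_def xx)
qed

end

lift_definition scaleC :: "complex \<Rightarrow> ell2 \<Rightarrow> ell2"  (infixr "*\<^sub>C" 75)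
  is "\<lambda>c x k. c * x k"
  by (simp add: norm_mult power_mult_distrib summable_mult)

definition cinner :: "ell2 \<Rightarrow> ell2 \<Rightarrow> complex"
  where "cinner x y = (\<Sum>k. coord x k * cnj (coord y k))"

type_synonym op = "ell2 \<Rightarrow>\<^sub>L ell2"

definition adj :: "op \<Rightarrow> op"
  where "adj A = (THE B :: op. \<forall>x y. cinner (A x) y = cinner x (B y))"

text \<open>The levels \<open>n \<in> \<nat> \<union> {\<aleph>\<^sub>0}\<close> with \<open>\<nat> = {1, 2, \<dots>}\<close>; the value \<open>\<infinity>\<close> stands for
  \<open>\<aleph>\<^sub>0\<close>. Level 0 has to be excluded: the zero operators on the zero space satisfy the
  definitions of pure and maximal vacuously.\<close>

definition levels :: "enat set"
  where "levels = {n. 1 \<le> n}"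

text \<open>\<open>\<ell>\<^sup>2(n)\<close> is the subspace of \<open>\<ell>\<^sup>2(\<aleph>\<^sub>0)\<close> of sequences supported on the first \<open>n\<close>
  coordinates, and an operator \<open>\<ell>\<^sup>2(n) \<rightarrow> \<ell>\<^sup>2(m)\<close> is identified with its extension by 0 on the
  orthogonal complement of \<open>\<ell>\<^sup>2(n)\<close>. This identification preserves norms, products and
  adjoints. The type \<open>op\<close> only requires real linearity, so complex linearity is imposed
  separately.\<close>

definition ell2_of :: "enat \<Rightarrow> ell2 set"
  where "ell2_of n = {x. \<forall>k. n \<le> enat k \<longrightarrow> coord x k = 0}"

definition ops :: "enat \<Rightarrow> enat \<Rightarrow> op set"
  where "ops n m = {A :: op.
    (\<forall>c x. A (c *\<^sub>C x) = c *\<^sub>C A x) \<and>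
    (\<forall>x. A x \<in> ell2_of m) \<and>
    (\<forall>x. (\<forall>k. enat k < n \<longrightarrow> coord x k = 0) \<longrightarrow> A x = 0)}"

definition isometry :: "enat \<Rightarrow> enat \<Rightarrow> op \<Rightarrow> bool"
  where "isometry n m V \<longleftrightarrow> V \<in> ops n m \<and> (\<forall>x\<in>ell2_of n. norm (V x) = norm x)"

definition compress :: "op \<Rightarrow> op \<times> op \<Rightarrow> op \<times> op"
  where "compress \<gamma> = (let f = (\<lambda>a. adj \<gamma> o\<^sub>L a o\<^sub>L \<gamma>) in map_prod f f)"

text \<open>\<open>T = \<Sum>j\<in>J. f j\<close> for operators on \<open>\<ell>\<^sup>2(n)\<close>, the sum being unconditionally convergent in the
  strong operator topology. Since only vectors of \<open>\<ell>\<^sup>2(n)\<close> are tested, \<open>id_blinfun\<close> serves as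
  the unit of \<open>B(\<ell>\<^sup>2(n))\<close> in this relation.\<close>

definition op_has_sum :: "enat \<Rightarrow> ('j \<Rightarrow> op) \<Rightarrow> 'j set \<Rightarrow> op \<Rightarrow> bool"
  where "op_has_sum n f J T \<longleftrightarrow> (\<forall>v\<in>ell2_of n. ((\<lambda>j. f j v) has_sum T v) J)"

text \<open>Index sets contained in \<open>nat\<close> cover all families: nonzero operators \<open>\<gamma> j\<close> on a separable
  space with \<open>\<Sum>j. (\<gamma> j)\<^sup>* (\<gamma> j) = 1\<close> form a countable family.\<close>

definition pure :: "(enat \<Rightarrow> (op \<times> op) set) \<Rightarrow> enat \<Rightarrow> op \<times> op \<Rightarrow> bool"
  where "pure K n x \<longleftrightarrow> x \<in> K n \<and>
    (\<forall>(J :: nat set) m y (\<gamma> :: nat \<Rightarrow> op).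
      (\<forall>j\<in>J. m j \<in> levels \<and> y j \<in> K (m j) \<and> \<gamma> j \<in> ops n (m j) \<and> \<gamma> j \<noteq> 0) \<and>
      bounded (\<gamma> ` J) \<and>
      op_has_sum n (\<lambda>j. adj (\<gamma> j) o\<^sub>L \<gamma> j) J id_blinfun \<and>
      op_has_sum n (\<lambda>j. fst (compress (\<gamma> j) (y j))) J (fst x) \<and>
      op_has_sum n (\<lambda>j. snd (compress (\<gamma> j) (y j))) J (snd x)
      \<longrightarrow> (\<forall>j\<in>J. \<exists>c (\<nu> :: op). isometry n (m j) \<nu> \<and> (\<forall>v. \<gamma> j v = c *\<^sub>C \<nu> v) \<and>
                   compress \<nu> (y j) = x))"

text \<open>Block matrices relative to \<open>\<ell>\<^sup>2(n) \<oplus> \<ell>\<^sup>2(k)\<close> are operators on \<open>\<ell>\<^sup>2(n + k)\<close> only after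
  a choice of unitary \<open>\<ell>\<^sup>2(n) \<oplus> \<ell>\<^sup>2(k) \<rightarrow> \<ell>\<^sup>2(m)\<close> (where necessarily \<open>m = n + k\<close>). We write
  it as \<open>(a, b) \<mapsto> u a + v b\<close> and allow every choice.\<close>

definition sum_unitary :: "enat \<Rightarrow> enat \<Rightarrow> enat \<Rightarrow> op \<Rightarrow> op \<Rightarrow> bool"
  where "sum_unitary n k m u v \<longleftrightarrow> u \<in> ops n m \<and> v \<in> ops k m \<and>
    (\<forall>a\<in>ell2_of n. \<forall>b\<in>ell2_of k. (norm (u a + v b))\<^sup>2 = (norm a)\<^sup>2 + (norm b)\<^sup>2) \<and>
    (\<forall>w\<in>ell2_of m. \<exists>a\<in>ell2_of n. \<exists>b\<in>ell2_of k. w = u a + v b)"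

definition block :: "op \<Rightarrow> op \<Rightarrow> op \<Rightarrow> op \<Rightarrow> op \<Rightarrow> op \<Rightarrow> op"
  where "block u v z11 z12 z21 z22 =
    (u o\<^sub>L z11 o\<^sub>L adj u) + (u o\<^sub>L z12 o\<^sub>L adj v) + (v o\<^sub>L z21 o\<^sub>L adj u) + (v o\<^sub>L z22 o\<^sub>L adj v)"

definition block2 ::
    "op \<Rightarrow> op \<Rightarrow> op \<times> op \<Rightarrow> op \<times> op \<Rightarrow> op \<times> op \<Rightarrow> op \<times> op \<Rightarrow> op \<times> op"
  where "block2 u v z11 z12 z21 z22 =
    (block u v (fst z11) (fst z12) (fst z21) (fst z22),
     block u v (snd z11) (snd z12) (snd z21) (snd z22))"

definition maximal :: "(enat \<Rightarrow> (op \<times> op) set) \<Rightarrow> enat \<Rightarrow> op \<times> op \<Rightarrow> bool"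
  where "maximal K n x \<longleftrightarrow> x \<in> K n \<and>
    (\<forall>k\<in>levels. \<forall>m\<in>levels. \<forall>u v z12 z21 z22.
      sum_unitary n k m u v \<and>
      z12 \<in> ops k n \<times> ops k n \<and> z21 \<in> ops n k \<times> ops n k \<and> z22 \<in> ops k k \<times> ops k k \<and>
      block2 u v x z12 z21 z22 \<in> K m
      \<longrightarrow> z12 = 0 \<and> z21 = 0 \<and> z22 \<in> K k)"

definition nc_extreme_points :: "(enat \<Rightarrow> (op \<times> op) set) \<Rightarrow> enat \<Rightarrow> (op \<times> op) set"
  where "nc_extreme_points K n = {x. pure K n x \<and> maximal K n x}"

definition nc_square :: "enat \<Rightarrow> (op \<times> op) set"
  where "nc_square n = {(a1, a2). a1 \<in> ops n n \<and> a2 \<in> ops n n \<and>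
    adj a1 = a1 \<and> adj a2 = a2 \<and> norm a1 \<le> 1 \<and> norm a2 \<le> 1}"

end

theory Submission
  imports Defs
begin

text \<open>
  Throughout, \<open>a\<close> and \<open>b\<close> are selfadjoint contractions on \<open>\<ell>\<^sup>2(n)\<close>.

  \<^bold>\<open>Maximality means that \<open>a\<close> and \<open>b\<close> are symmetries.\<close> If \<open>a\<^sup>2 = 1\<close>, then \<open>a\<close> is isometric, so a
  contraction with corner \<open>a\<close> has no room for an off-diagonal entry. Conversely, with
  \<open>d = 1 - a\<^sup>2\<close> the matrix with rows \<open>(a, d)\<close> and \<open>(d, -a)\<close> is a selfadjoint contraction: its
  square is diagonal with both entries \<open>a\<^sup>2 + d\<^sup>2 = 1 - a d a\<close>. This replaces the usual Halmos
  dilation and needs no square root of \<open>1 - a\<^sup>2\<close>. Maximality of \<open>(a, b)\<close> thus forces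
  \<open>a\<^sup>2 = b\<^sup>2 = 1\<close>; this is \<open>maximal_nc_square_iff\<close>.

  \<^bold>\<open>A pure pair of symmetries lives at level at most 2.\<close> Put \<open>w = a b\<close>, which is unitary, and
  \<open>\<gamma>\<^sub>\<plusminus> = (1 \<plusminus> w) / 2\<close>. Then \<open>\<gamma>\<^sub>+\<^sup>* \<gamma>\<^sub>+ + \<gamma>\<^sub>-\<^sup>* \<gamma>\<^sub>- = 1\<close>, and \<open>(a, b)\<close> is the combination with these
  coefficients of the two points \<open>\<plusminus>(a b a, a)\<close>. Purity makes \<open>\<gamma>\<^sub>+\<close> a multiple of an isometry, so
  \<open>\<gamma>\<^sub>+\<^sup>* \<gamma>\<^sub>+ = (2 + a b + b a) / 4\<close> is a scalar, and hence so is \<open>a b + b a\<close>. No spectral theorem is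
  involved. If \<open>e\<close> is an eigenvector of \<open>a\<close>, the span of \<open>e\<close> and \<open>b e\<close> is then invariant under
  both symmetries. Purity, applied to the projection \<open>p\<close> onto this span and to \<open>1 - p\<close>, gives
  \<open>p = 1\<close>; comparing the trace of \<open>p\<close> with three diagonal entries excludes \<open>n \<ge> 3\<close>. This is
  \<open>pure_reflections_level_le_2\<close>.

  \<^bold>\<open>Both levels occur.\<close> If a symmetry \<open>a\<close> is the combination of contractions \<open>y\<^sub>j\<close> with coefficients
  \<open>\<gamma>\<^sub>j\<close>, equality in the Cauchy--Schwarz inequality forces \<open>y\<^sub>j \<gamma>\<^sub>j = \<gamma>\<^sub>j a\<close>. Hence
  \<open>\<gamma>\<^sub>j\<^sup>* \<gamma>\<^sub>j\<close> commutes with \<open>a\<close> and \<open>b\<close>, and an irreducible pair of symmetries is pure; this is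
  \<open>pure_of_irreducible_reflections\<close>. Examples are \<open>(1, 1)\<close> at level 1, and \<open>diag(1, -1)\<close> with
  the flip of the two coordinates at level 2.

  Since all operators involved are complex linear, their adjoints can be computed from the real
  inner product \<open>x \<bullet> y = Re \<langle>x, y\<rangle>\<close>, and most of the arguments use it in place of \<open>cinner\<close>.
\<close>

section \<open>Square-summable sequences\<close>

lemma coord_add [simp]: "coord (x + y) k = coord x k + coord y k"
  by (simp add: plus_ell2.rep_eq)

lemma coord_uminus [simp]: "coord (- x) k = - coord x k"
  by (simp add: uminus_ell2.rep_eq)

lemma coord_diff [simp]: "coord (x - y) k = coord x k - coord y k"
  unfolding minus_ell2_def coord_add coord_uminus by simp

lemma coord_zero [simp]: "coord 0 k = 0"
  by (simp add: zero_ell2.rep_eq)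

lemma coord_scaleR [simp]: "coord (r *\<^sub>R x) k = r *\<^sub>R coord x k"
  by (simp add: scaleR_ell2.rep_eq)

lemma coord_scaleC [simp]: "coord (c *\<^sub>C x) k = c * coord x k"
  by (simp add: scaleC.rep_eq)

lemma ell2_eqI: "(\<And>k. coord x k = coord y k) \<Longrightarrow> x = y"
  by (simp add: coord_inject[symmetric] fun_eq_iff)

lemma summable_coord: "summable (\<lambda>k. (cmod (coord x k))\<^sup>2)"
  using coord[of x] by simp

lemma inner_sums: "(\<lambda>k. coord x k \<bullet> coord y k) sums (x \<bullet> y)"
  unfolding inner_ell2_def by (intro summable_sums ell2_summable_inner summable_coord)

lemma norm_sums: "(\<lambda>k. (cmod (coord x k))\<^sup>2) sums (norm x)\<^sup>2"
  using inner_sums[of x x] by (simp add: power2_norm_eq_inner)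

lemma norm_eqI_sums: "(\<lambda>k. (cmod (coord x k))\<^sup>2) sums r \<Longrightarrow> (norm x)\<^sup>2 = r"
  using norm_sums sums_unique2 by blast

lemma scaleC_of_real: "complex_of_real r *\<^sub>C x = r *\<^sub>R x"
  by (rule ell2_eqI) (simp add: scaleR_conv_of_real)

lemma scaleC_scaleC [simp]: "c *\<^sub>C d *\<^sub>C x = (c * d) *\<^sub>C x"
  by (rule ell2_eqI) simp

lemma scaleC_one [simp]: "1 *\<^sub>C x = x"
  by (rule ell2_eqI) simp

lemma scaleC_zero_left [simp]: "0 *\<^sub>C x = 0"
  by (rule ell2_eqI) simp

lemma scaleC_zero_right [simp]: "c *\<^sub>C 0 = 0"
  by (rule ell2_eqI) simp

lemma scaleC_add_right: "c *\<^sub>C (x + y) = c *\<^sub>C x + c *\<^sub>C y"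
  by (rule ell2_eqI) (simp add: algebra_simps)

lemma scaleC_diff_right: "c *\<^sub>C (x - y) = c *\<^sub>C x - c *\<^sub>C y"
  by (rule ell2_eqI) (simp add: algebra_simps)

lemma scaleC_uminus_right: "c *\<^sub>C (- x) = - (c *\<^sub>C x)"
  by (rule ell2_eqI) (simp add: algebra_simps)

lemma scaleC_scaleR: "c *\<^sub>C (r *\<^sub>R x) = r *\<^sub>R (c *\<^sub>C x)"
  by (rule ell2_eqI) (simp add: algebra_simps)

lemma inner_scaleC: "(c *\<^sub>C x) \<bullet> y = x \<bullet> (cnj c *\<^sub>C y)"
proof -
  have "(c * z) \<bullet> w = z \<bullet> (cnj c * w)" for z w :: complex
    by (simp add: inner_complex_def algebra_simps)
  then show ?thesis by (simp add: inner_ell2_def)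
qed

lemma norm_scaleC: "norm (c *\<^sub>C x) = cmod c * norm x"
proof -
  have "(norm (c *\<^sub>C x))\<^sup>2 = (cmod c * norm x)\<^sup>2"
    using sums_mult[OF norm_sums, of "(cmod c)\<^sup>2" x]
    by (intro norm_eqI_sums) (simp add: norm_mult power_mult_distrib)
  then show ?thesis by simp
qed

text \<open>The complex inner product is determined by its real part, which allows results on real inner
  product spaces to be used.\<close>

lemma cinner_eq_Complex_inner: "cinner x y = Complex (x \<bullet> y) (x \<bullet> (\<i> *\<^sub>C y))"
proof -
  have "(\<lambda>k. Complex (coord x k \<bullet> coord y k) (coord x k \<bullet> coord (\<i> *\<^sub>C y) k))
      sums Complex (x \<bullet> y) (x \<bullet> (\<i> *\<^sub>C y))"
    using inner_sums[of x y] inner_sums[of x "\<i> *\<^sub>C y"] unfolding sums_complex_iff by simp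
  moreover have "Complex (coord x k \<bullet> coord y k) (coord x k \<bullet> coord (\<i> *\<^sub>C y) k)
      = coord x k * cnj (coord y k)" for k
    by (simp add: complex_eq_iff inner_complex_def)
  ultimately show ?thesis
    unfolding cinner_def by (simp add: sums_iff)
qed

lift_definition basis_vec :: "nat \<Rightarrow> ell2" is "\<lambda>i k. if k = i then 1 else 0"
proof -
  fix i :: nat
  show "summable (\<lambda>k. (cmod (if k = i then 1 else 0))\<^sup>2)"
    by (rule summable_finite[of "{i}"]) auto
qed

lemma coord_basis_vec [simp]: "coord (basis_vec i) k = (if k = i then 1 else 0)"
  by (simp add: basis_vec.rep_eq)

lemma inner_basis_vec [simp]: "x \<bullet> (c *\<^sub>C basis_vec i) = coord x i \<bullet> c"
proof -
  have "(\<lambda>k. coord x k \<bullet> coord (c *\<^sub>C basis_vec i) k) sums (\<Sum>k\<in>{i}. coord x k \<bullet> coord (c *\<^sub>C basis_vec i) k)"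
    by (rule sums_finite) auto
  from sums_unique2[OF inner_sums this] show ?thesis by simp
qed

text \<open>Density of the finitely supported sequences, in the form in which the construction of adjoints
  needs it: bounded operators are determined by the standard basis.\<close>

lemma basis_expansion_sums: "(\<lambda>k. coord x k *\<^sub>C basis_vec k) sums x"
proof -
  let ?t = "\<lambda>N. \<Sum>k<N. coord x k *\<^sub>C basis_vec k"
  have ct: "coord (?t N) k = (if k < N then coord x k else 0)" for N k
    by (induction N) (auto simp: less_Suc_eq)
  have it: "y \<bullet> ?t N = (\<Sum>k<N. coord y k \<bullet> coord x k)" for y N
    by (simp add: inner_sum_right)
  have "(norm (x - ?t N))\<^sup>2 = (norm x)\<^sup>2 - (\<Sum>k<N. (cmod (coord x k))\<^sup>2)" for N
    using it[of x N] it[of "?t N" N] ct[of N]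
    by (simp add: power2_norm_eq_inner inner_diff inner_commute[of "?t N" x])
  moreover have "(\<lambda>N. (norm x)\<^sup>2 - (\<Sum>k<N. (cmod (coord x k))\<^sup>2)) \<longlonglongrightarrow> (norm x)\<^sup>2 - (norm x)\<^sup>2"
    using norm_sums[of x] unfolding sums_def by (intro tendsto_diff tendsto_const)
  ultimately have "(\<lambda>N. (norm (x - ?t N))\<^sup>2) \<longlonglongrightarrow> 0" by simp
  then have "(\<lambda>N. sqrt ((norm (x - ?t N))\<^sup>2)) \<longlonglongrightarrow> sqrt 0" by (rule tendsto_real_sqrt)
  then have "(\<lambda>N. norm (?t N - x)) \<longlonglongrightarrow> 0" by (simp add: norm_minus_commute)
  then show ?thesis
    unfolding sums_def using Lim_null tendsto_norm_zero_iff by blast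
qed

lemma cinner_add_right: "cinner x (y + z) = cinner x y + cinner x z"
  by (simp add: cinner_eq_Complex_inner scaleC_add_right inner_add_right complex_eq_iff)

lemma cinner_diff_right: "cinner x (y - z) = cinner x y - cinner x z"
  by (simp add: cinner_eq_Complex_inner scaleC_diff_right inner_diff_right complex_eq_iff)

lemma cinner_scaleR_right: "cinner x (r *\<^sub>R y) = r *\<^sub>R cinner x y"
  by (simp add: cinner_eq_Complex_inner scaleC_scaleR complex_eq_iff)

lemma cinner_scaleR_left: "cinner (r *\<^sub>R x) y = r *\<^sub>R cinner x y"
  by (simp add: cinner_eq_Complex_inner complex_eq_iff)

lemma cinner_uminus_right: "cinner x (- y) = - cinner x y"
  using cinner_scaleR_right[of x "-1" y] by simp

lemma cinner_uminus_left: "cinner (- x) y = - cinner x y"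
  using cinner_scaleR_left[of "-1" x y] by simp

lemma scaleC_expand: "c *\<^sub>C x = Re c *\<^sub>R x + Im c *\<^sub>R (\<i> *\<^sub>C x)"
  by (rule ell2_eqI) (simp add: complex_eq_iff)

lemma inner_ii_left: "(\<i> *\<^sub>C x) \<bullet> y = - (x \<bullet> (\<i> *\<^sub>C y))"
proof -
  have "(- \<i>) *\<^sub>C y = - (\<i> *\<^sub>C y)" by (rule ell2_eqI) simp
  then show ?thesis using inner_scaleC[of \<i> x y] by simp
qed

lemma cinner_scaleC_left: "cinner (c *\<^sub>C x) y = c * cinner x y"
proof -
  have "\<i> *\<^sub>C \<i> *\<^sub>C y = - y" by (rule ell2_eqI) simp
  then show ?thesis
    by (subst scaleC_expand)
      (simp add: cinner_eq_Complex_inner inner_add_left inner_ii_left complex_eq_iff)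
qed

lemma inner_ii_self: "x \<bullet> (\<i> *\<^sub>C x) = 0"
  using inner_ii_left[of x x] by (simp add: inner_commute)

lemma cinner_self: "cinner x x = of_real ((norm x)\<^sup>2)"
  by (simp add: cinner_eq_Complex_inner inner_ii_self complex_eq_iff power2_norm_eq_inner)

lemma cinner_basis_vec: "cinner (basis_vec k) x = cnj (coord x k)"
proof -
  have "basis_vec k \<bullet> x = Re (coord x k)" for x
    using inner_basis_vec[of x 1 k] by (simp add: inner_complex_def inner_commute)
  then show ?thesis
    by (simp add: cinner_eq_Complex_inner complex_eq_iff)
qed

section \<open>Existence of adjoints\<close>

text \<open>The type \<open>op\<close> contains all bounded real-linear maps; \<open>adj\<close> is only meaningful for the
  complex-linear ones.\<close>

definition complex_linear :: "op \<Rightarrow> bool"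
  where "complex_linear A \<longleftrightarrow> (\<forall>c x. A (c *\<^sub>C x) = c *\<^sub>C A x)"

text \<open>The coordinates of the adjoint applied to \<open>y\<close> can only be \<open>\<langle>y, A e\<^sub>k\<rangle>\<close>. They are
  square-summable because testing \<open>A\<close> on the partial sums \<open>z\<close> of the candidate gives
  \<open>\<parallel>z\<parallel>\<^sup>2 = Re \<langle>A z, y\<rangle> \<le> \<parallel>A\<parallel> \<parallel>z\<parallel> \<parallel>y\<parallel>\<close>. This avoids the Riesz representation theorem and
  completeness.\<close>

lemma real_adjoint_exists:
  assumes A: "complex_linear A"
  obtains B :: op where "\<And>x y. A x \<bullet> y = x \<bullet> B y"
proof -
  define g where "g y k = cinner y (A (basis_vec k))" for y k
  have g: "A (c *\<^sub>C basis_vec k) \<bullet> y = c \<bullet> g y k" for c k y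
  proof -
    have "A (c *\<^sub>C basis_vec k) \<bullet> y = c *\<^sub>C A (basis_vec k) \<bullet> y"
      using A by (simp add: complex_linear_def)
    also have "c *\<^sub>C A (basis_vec k) = Re c *\<^sub>R A (basis_vec k) + Im c *\<^sub>R (\<i> *\<^sub>C A (basis_vec k))"
      by (rule scaleC_expand)
    finally show ?thesis
      by (simp add: g_def cinner_eq_Complex_inner inner_complex_def inner_add inner_commute)
  qed
  have bound: "(\<Sum>k<N. (cmod (g y k))\<^sup>2) \<le> (norm A * norm y)\<^sup>2" for y N
  proof -
    \<comment> \<open>partial sum of the candidate for the adjoint at \<open>y\<close>\<close>
    define z where "z = (\<Sum>k<N. g y k *\<^sub>C basis_vec k)"
    define S where "S = (\<Sum>k<N. (cmod (g y k))\<^sup>2)"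
    have cz: "coord z k = (if k < N then g y k else 0)" for k
      unfolding z_def by (induction N) (auto simp: less_Suc_eq)
    have "z \<bullet> z = (\<Sum>k<N. z \<bullet> (g y k *\<^sub>C basis_vec k))"
      by (subst (2) z_def) (simp add: inner_sum_right)
    then have z: "(norm z)\<^sup>2 = S"
      by (simp add: S_def cz power2_norm_eq_inner)
    have "S = A z \<bullet> y"
      unfolding z_def S_def by (simp add: blinfun.sum_right inner_sum_left g power2_norm_eq_inner)
    also have "\<dots> \<le> norm (A z) * norm y" by (rule norm_cauchy_schwarz)
    also have "\<dots> \<le> norm A * norm z * norm y" by (intro mult_right_mono norm_blinfun) simp
    finally have "norm z * norm z \<le> norm z * (norm A * norm y)"
      using z by (simp add: power2_eq_square ac_simps)
    then have "norm z \<le> norm A * norm y"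
      by (cases "norm z = 0") (auto simp: mult_le_cancel_left)
    then show ?thesis using z power_mono[of "norm z" _ 2] by (simp add: S_def)
  qed
  have sg: "summable (\<lambda>k. (cmod (g y k))\<^sup>2)" for y
    by (rule summableI_nonneg_bounded[OF _ bound]) simp
  define b where "b y = Abs_ell2 (g y)" for y
  have cb: "coord (b y) k = g y k" for y k
    by (simp add: b_def Abs_ell2_inverse sg)
  have "bounded_linear b"
  proof
    show "b (x + y) = b x + b y" for x y
      by (rule ell2_eqI) (simp add: cb g_def cinner_eq_Complex_inner inner_add_left complex_eq_iff)
    show "b (r *\<^sub>R x) = r *\<^sub>R b x" for r x
      by (rule ell2_eqI) (simp add: cb g_def cinner_eq_Complex_inner complex_eq_iff)
    have "(norm (b x))\<^sup>2 \<le> (norm A * norm x)\<^sup>2" for x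
      using norm_sums[of "b x"] suminf_le_const[OF sg bound[of x]]
      by (simp add: sums_iff cb)
    then show "\<exists>K. \<forall>x. norm (b x) \<le> norm x * K"
      by (metis mult.commute norm_ge_zero mult_nonneg_nonneg power2_le_imp_le)
  qed
  moreover have "A x \<bullet> y = x \<bullet> b y" for x y
  proof -
    have "(\<lambda>k. A (coord x k *\<^sub>C basis_vec k) \<bullet> y) sums (A x \<bullet> y)"
      by (intro bounded_linear.sums[OF bounded_linear_inner_left]
          bounded_linear.sums[OF blinfun.bounded_linear_right]
          basis_expansion_sums)
    then have "(\<lambda>k. coord x k \<bullet> coord (b y) k) sums (A x \<bullet> y)" by (simp add: g cb)
    from sums_unique2[OF this inner_sums] show ?thesis .
  qed
  ultimately show thesis
    using that[of "Blinfun b"] by (simp add: bounded_linear_Blinfun_apply)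
qed

text \<open>The imaginary part of \<open>\<langle>A x, y\<rangle>\<close> is the real part for the vector \<open>- \<i> x\<close> in place of \<open>x\<close>, so
  for complex-linear \<open>A\<close> the real adjoint relation already gives the complex one.\<close>

lemma cinner_adjoint_iff:
  fixes A B :: op
  assumes A: "complex_linear A"
  shows "(\<forall>x y. cinner (A x) y = cinner x (B y)) \<longleftrightarrow> (\<forall>x y. A x \<bullet> y = x \<bullet> B y)"
proof
  assume r: "\<forall>x y. A x \<bullet> y = x \<bullet> B y"
  have "A x \<bullet> (\<i> *\<^sub>C y) = x \<bullet> (\<i> *\<^sub>C B y)" for x y
  proof -
    have "A x \<bullet> (\<i> *\<^sub>C y) = A ((-\<i>) *\<^sub>C x) \<bullet> y"
      using A inner_scaleC[of "-\<i>" "A x" y] by (simp add: complex_linear_def)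
    also have "\<dots> = x \<bullet> (\<i> *\<^sub>C B y)"
      using r inner_scaleC[of "-\<i>" x "B y"] by simp
    finally show ?thesis .
  qed
  with r show "\<forall>x y. cinner (A x) y = cinner x (B y)"
    by (simp add: cinner_eq_Complex_inner)
qed (simp add: cinner_eq_Complex_inner)

lemma adj_unique:
  fixes A B :: op
  assumes "complex_linear A" "\<And>x y. A x \<bullet> y = x \<bullet> B y"
  shows "adj A = B"
  unfolding adj_def cinner_adjoint_iff[OF assms(1)]
proof (rule the_equality)
  show "\<forall>x y. A x \<bullet> y = x \<bullet> B y" using assms(2) by blast
  fix C :: op assume C: "\<forall>x y. A x \<bullet> y = x \<bullet> C y"
  show "C = B"
    by (rule blinfun_eqI) (use C assms(2) in \<open>metis vector_eq_ldot\<close>)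
qed

lemma inner_adj: "complex_linear A \<Longrightarrow> A x \<bullet> y = x \<bullet> adj A y"
  by (metis real_adjoint_exists adj_unique)

lemma complex_linear_adj:
  assumes "complex_linear A"
  shows "complex_linear (adj A)"
  unfolding complex_linear_def
proof (intro allI)
  fix c y
  have "x \<bullet> adj A (c *\<^sub>C y) = x \<bullet> (c *\<^sub>C adj A y)" for x
  proof -
    have "x \<bullet> (c *\<^sub>C adj A y) = A (cnj c *\<^sub>C x) \<bullet> y"
      using inner_scaleC[of "cnj c" x] inner_adj[OF assms] by simp
    also have "\<dots> = x \<bullet> adj A (c *\<^sub>C y)"
      using assms inner_scaleC[of "cnj c" "A x"] inner_adj[OF assms] by (simp add: complex_linear_def)
    finally show ?thesis by simp
  qed
  then show "adj A (c *\<^sub>C y) = c *\<^sub>C adj A y" by (metis vector_eq_ldot)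
qed

section \<open>Operators between levels\<close>

lift_definition truncate :: "enat \<Rightarrow> ell2 \<Rightarrow> ell2" is "\<lambda>n x k. if enat k < n then x k else 0"
proof -
  fix n and x :: "nat \<Rightarrow> complex" assume "summable (\<lambda>k. (cmod (x k))\<^sup>2)"
  then show "summable (\<lambda>k. (cmod (if enat k < n then x k else 0))\<^sup>2)"
    by (rule summable_comparison_test'[where N = 0]) simp
qed

text \<open>The unit of \<open>B(\<ell>\<^sup>2(n))\<close>, extended by 0. It turns membership in \<open>ell2_of\<close> and \<open>ops\<close> into
  equations, with which the simplifier can work.\<close>

lift_definition proj :: "enat \<Rightarrow> op" is truncate
proof
  fix n x y r
  show "truncate n (x + y) = truncate n x + truncate n y" "truncate n (r *\<^sub>R x) = r *\<^sub>R truncate n x"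
    by (auto intro!: ell2_eqI simp: truncate.rep_eq)
  have "(norm (truncate n x))\<^sup>2 \<le> (norm x)\<^sup>2" for x
    by (rule sums_le[OF _ norm_sums norm_sums]) (simp add: truncate.rep_eq)
  then have "norm (truncate n x) \<le> norm x * 1" for x by simp
  then show "\<exists>K. \<forall>x. norm (truncate n x) \<le> norm x * K" by blast
qed

lemma coord_proj [simp]: "coord (proj n x) k = (if enat k < n then coord x k else 0)"
  by (simp add: proj.rep_eq truncate.rep_eq)

lemma norm_proj_le: "norm (proj n x) \<le> norm x"
proof -
  have "(norm (proj n x))\<^sup>2 \<le> (norm x)\<^sup>2"
    by (rule sums_le[OF _ norm_sums norm_sums]) simp
  then show ?thesis by simp
qed

lemma proj_idem [simp]: "proj n (proj n x) = proj n x"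
  by (rule ell2_eqI) simp

lemma inner_proj: "proj n x \<bullet> y = x \<bullet> proj n y"
proof -
  have "coord (proj n x) k \<bullet> coord y k = coord x k \<bullet> coord (proj n y) k" for k by simp
  then show ?thesis unfolding inner_ell2_def by presburger
qed

lemma ell2_of_iff: "x \<in> ell2_of n \<longleftrightarrow> proj n x = x"
  unfolding ell2_of_def coord_inject[symmetric] fun_eq_iff by (auto simp: not_less)

lemma ops_iff:
  "A \<in> ops n m \<longleftrightarrow> complex_linear A \<and> (\<forall>x. proj m (A x) = A x) \<and> (\<forall>x. A (proj n x) = A x)"
proof -
  have "(\<forall>x. (\<forall>k. enat k < n \<longrightarrow> coord x k = 0) \<longrightarrow> A x = 0) \<longleftrightarrow> (\<forall>x. A (proj n x) = A x)"
  proof (intro iffI allI impI)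
    fix x assume "\<forall>x. (\<forall>k. enat k < n \<longrightarrow> coord x k = 0) \<longrightarrow> A x = 0"
    \<comment> \<open>\<open>x - proj n x\<close> vanishes on the first \<open>n\<close> coordinates\<close>
    then have "A (x - proj n x) = 0" by simp
    then show "A (proj n x) = A x" by (simp add: blinfun.diff_right)
  next
    fix x assume *: "\<forall>x. A (proj n x) = A x" and "\<forall>k. enat k < n \<longrightarrow> coord x k = 0"
    then have "proj n x = 0" by (intro ell2_eqI) simp
    then show "A x = 0" using * by (metis blinfun.zero_right)
  qed
  then show ?thesis by (simp add: ops_def complex_linear_def ell2_of_iff)
qed

lemma ops_complex_linear: "A \<in> ops n m \<Longrightarrow> complex_linear A"
  and ops_proj_left: "A \<in> ops n m \<Longrightarrow> proj m (A x) = A x"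
  and ops_proj_right: "A \<in> ops n m \<Longrightarrow> A (proj n x) = A x"
  and ops_range: "A \<in> ops n m \<Longrightarrow> A x \<in> ell2_of m"
  by (simp_all add: ops_iff ell2_of_iff)

lemma ops_inner_adj: "A \<in> ops n m \<Longrightarrow> A x \<bullet> y = x \<bullet> adj A y"
  by (simp add: inner_adj ops_complex_linear)

lemma proj_in_ops: "proj n \<in> ops n n"
  by (auto simp: ops_iff complex_linear_def intro!: ell2_eqI)

lemma ops_comp: "A \<in> ops n m \<Longrightarrow> B \<in> ops m k \<Longrightarrow> B o\<^sub>L A \<in> ops n k"
  by (simp add: ops_iff complex_linear_def)

lemma ops_add: "A \<in> ops n m \<Longrightarrow> B \<in> ops n m \<Longrightarrow> A + B \<in> ops n m"
  by (simp add: ops_iff complex_linear_def scaleC_add_right blinfun.add_left blinfun.add_right)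

lemma ops_diff: "A \<in> ops n m \<Longrightarrow> B \<in> ops n m \<Longrightarrow> A - B \<in> ops n m"
  by (simp add: ops_iff complex_linear_def scaleC_diff_right blinfun.diff_left blinfun.diff_right)

lemma ops_uminus: "A \<in> ops n m \<Longrightarrow> - A \<in> ops n m"
  by (simp add: ops_iff complex_linear_def scaleC_uminus_right blinfun.minus_left blinfun.minus_right)

lemma ops_scaleR: "A \<in> ops n m \<Longrightarrow> r *\<^sub>R A \<in> ops n m"
  by (simp add: ops_iff complex_linear_def scaleC_scaleR blinfun.scaleR_left blinfun.scaleR_right)

lemma ops_zero: "0 \<in> ops n m"
  by (simp add: ops_iff complex_linear_def)

lemma ops_adj:
  assumes A: "A \<in> ops n m"
  shows "adj A \<in> ops m n"
proof -
  have "x \<bullet> proj n (adj A y) = x \<bullet> adj A y" for x y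
    by (metis A inner_proj ops_inner_adj ops_proj_right)
  moreover have "x \<bullet> adj A (proj m y) = x \<bullet> adj A y" for x y
    by (metis A inner_proj ops_inner_adj ops_proj_left)
  ultimately show ?thesis
    unfolding ops_iff using complex_linear_adj ops_complex_linear[OF A] by (metis vector_eq_ldot)
qed

lemmas ops_intros = proj_in_ops ops_comp ops_add ops_diff ops_uminus ops_scaleR ops_zero ops_adj

lemma adj_eqI:
  assumes A: "A \<in> ops n m" and B: "B \<in> ops m n"
    and *: "\<And>x y. x \<in> ell2_of n \<Longrightarrow> y \<in> ell2_of m \<Longrightarrow> A x \<bullet> y = x \<bullet> B y"
  shows "adj A = B"
proof (rule adj_unique[OF ops_complex_linear[OF A]])
  fix x y
  have "A x \<bullet> y = A (proj n x) \<bullet> proj m y"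
    by (metis A inner_proj ops_proj_left ops_proj_right)
  also have "\<dots> = proj n x \<bullet> B (proj m y)" by (intro *) (simp_all add: ell2_of_iff)
  also have "\<dots> = x \<bullet> B y" by (simp add: inner_proj ops_proj_left[OF B] ops_proj_right[OF B])
  finally show "A x \<bullet> y = x \<bullet> B y" .
qed

lemma ops_eqI:
  assumes A: "A \<in> ops n m" and B: "B \<in> ops n m" and "\<And>x. x \<in> ell2_of n \<Longrightarrow> A x = B x"
  shows "A = B"
proof (rule blinfun_eqI)
  fix x show "A x = B x"
    using assms(3)[of "proj n x"] by (simp add: ell2_of_iff ops_proj_right[OF A] ops_proj_right[OF B])
qed

lemma ops_norm_le:
  assumes A: "A \<in> ops n m" and r: "0 \<le> r" and *: "\<And>x. x \<in> ell2_of n \<Longrightarrow> norm (A x) \<le> r * norm x"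
  shows "norm A \<le> r"
proof (rule norm_blinfun_bound[OF r])
  fix x
  have "norm (A x) \<le> r * norm (proj n x)"
    using *[of "proj n x"] by (simp add: ell2_of_iff ops_proj_right[OF A])
  then show "norm (A x) \<le> r * norm x"
    using norm_proj_le[of n x] r by (meson mult_left_mono order_trans)
qed

lemma contraction_norm: "norm (A :: op) \<le> 1 \<Longrightarrow> norm (A x) \<le> norm x"
  using norm_blinfun[of A x] by (metis mult_right_mono mult_1 norm_ge_zero order_trans)

section \<open>Rank-one operators\<close>

lemma cinner_proj: "cinner (proj n x) y = cinner x (proj n y)"
  using cinner_adjoint_iff[of "proj n" "proj n"] by (simp add: inner_proj ops_complex_linear[OF proj_in_ops])

lift_definition rank_one :: "ell2 \<Rightarrow> ell2 \<Rightarrow> op" is "\<lambda>e f x. cinner x f *\<^sub>C e"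
proof -
  fix e f
  have "(\<lambda>x. cinner x f *\<^sub>C e) = (\<lambda>x. (x \<bullet> f) *\<^sub>R e + (x \<bullet> (\<i> *\<^sub>C f)) *\<^sub>R (\<i> *\<^sub>C e))"
    by (rule ext, rule ell2_eqI) (simp add: cinner_eq_Complex_inner complex_eq_iff)
  then show "bounded_linear (\<lambda>x. cinner x f *\<^sub>C e)"
    by (simp only:) (intro bounded_linear_intros)
qed

lemma rank_one_apply [simp]: "rank_one e f x = cinner x f *\<^sub>C e"
  by (simp add: rank_one.rep_eq)

lemma rank_one_ops:
  assumes "f \<in> ell2_of n" "e \<in> ell2_of m"
  shows "rank_one e f \<in> ops n m"
  using assms by (auto simp: ops_iff complex_linear_def cinner_proj ell2_of_iff cinner_scaleC_left
      ops_complex_linear[OF proj_in_ops, unfolded complex_linear_def])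

lemma inner_rank_one: "rank_one e f x \<bullet> y = x \<bullet> rank_one f e y"
proof -
  have exp: "cinner x f *\<^sub>C e = (x \<bullet> f) *\<^sub>R e + (x \<bullet> (\<i> *\<^sub>C f)) *\<^sub>R (\<i> *\<^sub>C e)" for x e f
    by (rule ell2_eqI) (simp add: cinner_eq_Complex_inner complex_eq_iff)
  show ?thesis
    by (simp add: exp inner_add inner_commute)
qed

section \<open>Selfadjoint contractions and symmetries\<close>

lemma ell2_of_add: "x \<in> ell2_of n \<Longrightarrow> y \<in> ell2_of n \<Longrightarrow> x + y \<in> ell2_of n"
  and ell2_of_diff: "x \<in> ell2_of n \<Longrightarrow> y \<in> ell2_of n \<Longrightarrow> x - y \<in> ell2_of n"
  and ell2_of_uminus: "x \<in> ell2_of n \<Longrightarrow> - x \<in> ell2_of n"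
  and ell2_of_scaleR: "x \<in> ell2_of n \<Longrightarrow> r *\<^sub>R x \<in> ell2_of n"
  and ell2_of_zero: "0 \<in> ell2_of n"
  by (simp_all add: ell2_of_def)

definition sa_contractions :: "enat \<Rightarrow> op set"
  where "sa_contractions n = {a \<in> ops n n. adj a = a \<and> norm a \<le> 1}"

lemma nc_square_eq: "nc_square n = sa_contractions n \<times> sa_contractions n"
  by (auto simp: nc_square_def sa_contractions_def)

lemma sa_contractions_iff:
  assumes a: "a \<in> ops n n"
  shows "a \<in> sa_contractions n \<longleftrightarrow>
    (\<forall>x\<in>ell2_of n. \<forall>y\<in>ell2_of n. a x \<bullet> y = x \<bullet> a y) \<and>
    (\<forall>x\<in>ell2_of n. (norm (a x))\<^sup>2 \<le> (norm x)\<^sup>2)"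
proof -
  have "adj a = a \<longleftrightarrow> (\<forall>x\<in>ell2_of n. \<forall>y\<in>ell2_of n. a x \<bullet> y = x \<bullet> a y)"
    using adj_eqI[OF a a] ops_inner_adj[OF a] by metis
  moreover have "norm a \<le> 1 \<longleftrightarrow> (\<forall>x\<in>ell2_of n. (norm (a x))\<^sup>2 \<le> (norm x)\<^sup>2)"
    using ops_norm_le[OF a, of 1] contraction_norm[of a] by auto
  ultimately show ?thesis using a by (simp add: sa_contractions_def)
qed

lemma sa_contractions_ops: "a \<in> sa_contractions n \<Longrightarrow> a \<in> ops n n"
  and sa_contractions_norm: "a \<in> sa_contractions n \<Longrightarrow> norm a \<le> 1"
  by (simp_all add: sa_contractions_def)

lemma sa_contractions_inner: "a \<in> sa_contractions n \<Longrightarrow> a x \<bullet> y = x \<bullet> a y"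
  using ops_inner_adj[of a n n x y] by (simp add: sa_contractions_def)

lemma cinner_sa_contraction: "a \<in> sa_contractions n \<Longrightarrow> cinner (a x) y = cinner x (a y)"
  using cinner_adjoint_iff[of a a] by (simp add: sa_contractions_inner ops_complex_linear[OF sa_contractions_ops])

text \<open>The symmetries, that is, the selfadjoint unitaries, of \<open>B(\<ell>\<^sup>2(n))\<close>.\<close>

definition reflection :: "enat \<Rightarrow> op \<Rightarrow> bool"
  where "reflection n a \<longleftrightarrow> a \<in> sa_contractions n \<and> (\<forall>x\<in>ell2_of n. a (a x) = x)"

text \<open>A selfadjoint involution is isometric, so it is automatically a contraction.\<close>

lemma reflectionI:
  assumes a: "a \<in> ops n n" and sa: "adj a = a" and aa: "\<And>x. x \<in> ell2_of n \<Longrightarrow> a (a x) = x"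
  shows "reflection n a"
proof -
  have "(norm (a x))\<^sup>2 \<le> (norm x)\<^sup>2" if "x \<in> ell2_of n" for x
  proof -
    have "a x \<bullet> a x = x \<bullet> a (a x)" using ops_inner_adj[OF a, of x] sa by simp
    then show ?thesis using aa[OF that] by (simp add: power2_norm_eq_inner)
  qed
  then have "a \<in> sa_contractions n"
    unfolding sa_contractions_iff[OF a] using ops_inner_adj[OF a] sa by simp
  then show ?thesis by (simp add: reflection_def aa)
qed

section \<open>Block matrices\<close>

text \<open>Polarization of the norm condition in \<open>sum_unitary\<close>.\<close>

lemma sum_unitary_inner:
  assumes u: "sum_unitary n k m u v"
    and "a \<in> ell2_of n" "b \<in> ell2_of k" "a' \<in> ell2_of n" "b' \<in> ell2_of k"
  shows "(u a + v b) \<bullet> (u a' + v b') = a \<bullet> a' + b \<bullet> b'"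
proof -
  have "(norm (u (a + a') + v (b + b')))\<^sup>2 = (norm (a + a'))\<^sup>2 + (norm (b + b'))\<^sup>2"
    "(norm (u a + v b))\<^sup>2 = (norm a)\<^sup>2 + (norm b)\<^sup>2"
    "(norm (u a' + v b'))\<^sup>2 = (norm a')\<^sup>2 + (norm b')\<^sup>2"
    using assms by (auto simp: sum_unitary_def ell2_of_add)
  moreover have "u (a + a') + v (b + b') = (u a + v b) + (u a' + v b')"
    by (simp add: blinfun.add_right)
  ultimately show ?thesis
    by (simp add: power2_norm_eq_inner inner_add inner_commute)
qed

lemma sum_unitary_adj:
  assumes u: "sum_unitary n k m u v" and ab: "a \<in> ell2_of n" "b \<in> ell2_of k"
  shows "adj u (u a + v b) = a" "adj v (u a + v b) = b"
proof -
  have uv: "u \<in> ops n m" "v \<in> ops k m" using u by (simp_all add: sum_unitary_def)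
  have "y \<bullet> adj u (u a + v b) = y \<bullet> a" for y
  proof -
    have "y \<bullet> adj u (u a + v b) = (u (proj n y) + v 0) \<bullet> (u a + v b)"
      by (simp add: ops_inner_adj[OF uv(1), symmetric] ops_proj_right[OF uv(1)])
    also have "\<dots> = proj n y \<bullet> a"
      using sum_unitary_inner[OF u, of "proj n y" 0 a b] ab by (simp add: ell2_of_iff)
    finally show ?thesis using ab by (simp add: inner_proj ell2_of_iff)
  qed
  then show "adj u (u a + v b) = a" by (metis vector_eq_ldot)
  have "y \<bullet> adj v (u a + v b) = y \<bullet> b" for y
  proof -
    have "y \<bullet> adj v (u a + v b) = (u 0 + v (proj k y)) \<bullet> (u a + v b)"
      by (simp add: ops_inner_adj[OF uv(2), symmetric] ops_proj_right[OF uv(2)])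
    also have "\<dots> = proj k y \<bullet> b"
      using sum_unitary_inner[OF u, of 0 "proj k y" a b] ab by (simp add: ell2_of_iff)
    finally show ?thesis using ab by (simp add: inner_proj ell2_of_iff)
  qed
  then show "adj v (u a + v b) = b" by (metis vector_eq_ldot)
qed

lemma block_apply:
  assumes "sum_unitary n k m u v" "a \<in> ell2_of n" "b \<in> ell2_of k"
  shows "block u v z11 z12 z21 z22 (u a + v b) = u (z11 a + z12 b) + v (z21 a + z22 b)"
  unfolding block_def
  by (simp add: blinfun.add_left sum_unitary_adj[OF assms]) (simp add: blinfun.add_right)

text \<open>Unitary conjugation preserves adjoints and norms, so whether a block matrix is a selfadjoint
  contraction is decided by its entries acting on \<open>\<ell>\<^sup>2(n) \<oplus> \<ell>\<^sup>2(k)\<close>.\<close>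

lemma block_sa_contractions_iff:
  assumes u: "sum_unitary n k m u v"
    and z: "z11 \<in> ops n n" "z12 \<in> ops k n" "z21 \<in> ops n k" "z22 \<in> ops k k"
  shows "block u v z11 z12 z21 z22 \<in> sa_contractions m \<longleftrightarrow>
    (\<forall>a\<in>ell2_of n. \<forall>b\<in>ell2_of k. \<forall>a'\<in>ell2_of n. \<forall>b'\<in>ell2_of k.
      (z11 a + z12 b) \<bullet> a' + (z21 a + z22 b) \<bullet> b' = a \<bullet> (z11 a' + z12 b') + b \<bullet> (z21 a' + z22 b')) \<and>
    (\<forall>a\<in>ell2_of n. \<forall>b\<in>ell2_of k.
      (norm (z11 a + z12 b))\<^sup>2 + (norm (z21 a + z22 b))\<^sup>2 \<le> (norm a)\<^sup>2 + (norm b)\<^sup>2)"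
    (is "?M \<in> _ \<longleftrightarrow> _")
proof -
  have uv: "u \<in> ops n m" "v \<in> ops k m" using u by (simp_all add: sum_unitary_def)
  have M: "?M \<in> ops m m"
    unfolding block_def by (rule ops_intros uv z)+
  have all: "(\<forall>w\<in>ell2_of m. P w) \<longleftrightarrow> (\<forall>a\<in>ell2_of n. \<forall>b\<in>ell2_of k. P (u a + v b))" for P
    using u unfolding sum_unitary_def by (metis ell2_of_add ops_range)
  have in_range: "z11 a + z12 b \<in> ell2_of n" "z21 a + z22 b \<in> ell2_of k" for a b
    using z by (auto intro: ell2_of_add ops_range)
  have nrm: "(norm (u a + v b))\<^sup>2 = (norm a)\<^sup>2 + (norm b)\<^sup>2" if "a \<in> ell2_of n" "b \<in> ell2_of k" for a b
    using u that by (simp add: sum_unitary_def)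
  show ?thesis
    unfolding sa_contractions_iff[OF M] all
    by (simp add: block_apply[OF u] nrm in_range sum_unitary_inner[OF u] cong: ball_cong)
qed

text \<open>Since \<open>\<parallel>a p\<parallel> = \<parallel>p\<parallel>\<close>, the contractive column \<open>(a p, z\<^sub>2\<^sub>1 p)\<close> has no room for its second
  entry. By symmetry the other off-diagonal entry, its adjoint, vanishes as well.\<close>

lemma reflection_dilation_trivial:
  assumes u: "sum_unitary n k m u v"
    and a: "reflection n a"
    and z: "z12 \<in> ops k n" "z21 \<in> ops n k" "z22 \<in> ops k k"
    and M: "block u v a z12 z21 z22 \<in> sa_contractions m"
  shows "z12 = 0" "z21 = 0" "z22 \<in> sa_contractions k"
proof -
  have a_ops: "a \<in> ops n n"
    using a by (simp add: reflection_def sa_contractions_ops)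
  note M' = M[unfolded block_sa_contractions_iff[OF u a_ops z]]
  have sym: "(a p + z12 q) \<bullet> p' + (z21 p + z22 q) \<bullet> q' = p \<bullet> (a p' + z12 q') + q \<bullet> (z21 p' + z22 q')"
    if "p \<in> ell2_of n" "q \<in> ell2_of k" "p' \<in> ell2_of n" "q' \<in> ell2_of k" for p q p' q'
    using M' that by blast
  have contr: "(norm (a p + z12 q))\<^sup>2 + (norm (z21 p + z22 q))\<^sup>2 \<le> (norm p)\<^sup>2 + (norm q)\<^sup>2"
    if "p \<in> ell2_of n" "q \<in> ell2_of k" for p q
    using M' that by blast
  have z21: "z21 p = 0" if "p \<in> ell2_of n" for p
  proof -
    have "a p \<bullet> a p = p \<bullet> p"
      using a that sa_contractions_inner[of a n p "a p"] by (simp add: reflection_def)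
    then have "norm (a p) = norm p" by (simp add: norm_eq_sqrt_inner)
    then show ?thesis
      using contr[OF that ell2_of_zero] by simp
  qed
  show "z21 = 0" by (rule ops_eqI[OF z(2) ops_zero]) (simp add: z21)
  have z12: "z12 q = 0" if "q \<in> ell2_of k" for q
  proof -
    have "z12 q \<bullet> z12 q = 0"
      using sym[of 0 q "z12 q" 0] that by (simp add: ell2_of_zero ops_range[OF z(1)] z21)
    then show ?thesis by simp
  qed
  show "z12 = 0" by (rule ops_eqI[OF z(1) ops_zero]) (simp add: z12)
  show "z22 \<in> sa_contractions k"
    unfolding sa_contractions_iff[OF z(3)]
    using sym[of 0 _ 0] contr[of 0] by (simp add: ell2_of_zero z12)
qed

section \<open>Maximal points of the square\<close>

text \<open>A model of \<open>\<ell>\<^sup>2(n) \<oplus> \<ell>\<^sup>2(n) \<cong> \<ell>\<^sup>2(n + n)\<close> that treats finite and infinite \<open>n\<close> alike: the summands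
  occupy the even and the odd coordinates. Concatenation would not work for infinite \<open>n\<close>.\<close>

lift_definition interleave :: "ell2 \<Rightarrow> ell2 \<Rightarrow> ell2"
  is "\<lambda>x y k. if even k then x (k div 2) else y (k div 2)"
proof -
  fix x y :: "nat \<Rightarrow> complex"
  assume x: "summable (\<lambda>k. (cmod (x k))\<^sup>2)" and y: "summable (\<lambda>k. (cmod (y k))\<^sup>2)"
  have "summable (\<lambda>k. if even k then (cmod (x (k div 2)))\<^sup>2 else (cmod (y ((k - 1) div 2)))\<^sup>2)"
    by (rule sums_summable[OF sums_if[OF summable_sums[OF y] summable_sums[OF x]]])
  also have "(\<lambda>k. if even k then (cmod (x (k div 2)))\<^sup>2 else (cmod (y ((k - 1) div 2)))\<^sup>2)
      = (\<lambda>k. (cmod (if even k then x (k div 2) else y (k div 2)))\<^sup>2)"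
    by (auto simp: fun_eq_iff elim!: oddE)
  finally show "summable (\<lambda>k. (cmod (if even k then x (k div 2) else y (k div 2)))\<^sup>2)" .
qed

lemma coord_interleave: "coord (interleave x y) k = (if even k then coord x (k div 2) else coord y (k div 2))"
  by (simp add: interleave.rep_eq)

lemma norm_interleave: "(norm (interleave x y))\<^sup>2 = (norm x)\<^sup>2 + (norm y)\<^sup>2"
proof -
  have "(\<lambda>k. if even k then (cmod (coord x (k div 2)))\<^sup>2 else (cmod (coord y ((k - 1) div 2)))\<^sup>2)
      sums ((norm y)\<^sup>2 + (norm x)\<^sup>2)"
    by (rule sums_if[OF norm_sums norm_sums])
  also have "(\<lambda>k. if even k then (cmod (coord x (k div 2)))\<^sup>2 else (cmod (coord y ((k - 1) div 2)))\<^sup>2)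
      = (\<lambda>k. (cmod (coord (interleave x y) k))\<^sup>2)"
    by (auto simp: coord_interleave fun_eq_iff elim!: oddE)
  finally show ?thesis by (subst add.commute) (rule norm_eqI_sums)
qed

lemma interleave_surj: obtains a b where "w = interleave a b"
proof -
  have s: "summable (\<lambda>k. (cmod (coord w (h k)))\<^sup>2)" if "inj h" for h
    using summable_reindex[OF summable_coord[of w] that] by (simp add: o_def)
  have "inj (\<lambda>k::nat. 2 * k)" "inj (\<lambda>k::nat. Suc (2 * k))" by (auto simp: inj_def)
  note s = s[OF this(1)] s[OF this(2)]
  have "w = interleave (Abs_ell2 (\<lambda>k. coord w (2 * k))) (Abs_ell2 (\<lambda>k. coord w (Suc (2 * k))))"
    by (rule ell2_eqI) (auto simp: coord_interleave Abs_ell2_inverse s elim!: oddE)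
  then show thesis by (rule that)
qed

lift_definition even_shift :: op is "\<lambda>x. interleave x 0"
proof
  fix x y r
  show "interleave (x + y) 0 = interleave x 0 + interleave y 0"
    "interleave (r *\<^sub>R x) 0 = r *\<^sub>R interleave x 0"
    by (auto intro!: ell2_eqI simp: coord_interleave)
  have "(norm (interleave x 0))\<^sup>2 = (norm x)\<^sup>2" for x by (simp add: norm_interleave)
  then show "\<exists>K. \<forall>x. norm (interleave x 0) \<le> norm x * K"
    by (intro exI[of _ 1]) (simp add: power2_eq_iff_nonneg)
qed

lift_definition odd_shift :: op is "\<lambda>x. interleave 0 x"
proof
  fix x y r
  show "interleave 0 (x + y) = interleave 0 x + interleave 0 y"
    "interleave 0 (r *\<^sub>R x) = r *\<^sub>R interleave 0 x"
    by (auto intro!: ell2_eqI simp: coord_interleave)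
  have "(norm (interleave 0 x))\<^sup>2 = (norm x)\<^sup>2" for x by (simp add: norm_interleave)
  then show "\<exists>K. \<forall>x. norm (interleave 0 x) \<le> norm x * K"
    by (intro exI[of _ 1]) (simp add: power2_eq_iff_nonneg)
qed

lemma enat_half_less:
  "enat (k div 2) < n \<longleftrightarrow> enat k < n + n"
  by (cases n) auto

lemma sum_unitary_interleave:
  "sum_unitary n n (n + n) (even_shift o\<^sub>L proj n) (odd_shift o\<^sub>L proj n)"
proof -
  let ?u = "even_shift o\<^sub>L proj n" and ?v = "odd_shift o\<^sub>L proj n"
  have uv: "?u a + ?v b = interleave (proj n a) (proj n b)" for a b
    by (rule ell2_eqI) (simp add: even_shift.rep_eq odd_shift.rep_eq coord_interleave)
  have "?u \<in> ops n (n + n)" "?v \<in> ops n (n + n)"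
    by (auto simp: ops_iff complex_linear_def even_shift.rep_eq odd_shift.rep_eq coord_interleave
        enat_half_less intro!: ell2_eqI)
  moreover have "\<exists>a\<in>ell2_of n. \<exists>b\<in>ell2_of n. w = ?u a + ?v b" if w: "w \<in> ell2_of (n + n)" for w
  proof -
    obtain a b where ab: "w = interleave a b" by (rule interleave_surj)
    have "w = proj (n + n) (interleave a b)"
      using w ab by (simp add: ell2_of_iff)
    also have "\<dots> = ?u (proj n a) + ?v (proj n b)"
      unfolding uv by (rule ell2_eqI) (simp add: coord_interleave enat_half_less)
    finally show ?thesis by (rule bexI[of _ "proj n a", OF bexI[of _ "proj n b"]]) (simp_all add: ell2_of_iff)
  qed
  ultimately show ?thesis
    unfolding sum_unitary_def uv by (simp add: norm_interleave ell2_of_iff)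
qed

text \<open>The obstruction to being a symmetry; the off-diagonal entry of the dilation below.\<close>

definition defect :: "enat \<Rightarrow> op \<Rightarrow> op"
  where "defect n a = proj n - (a o\<^sub>L a)"

lemma defect_ops: "a \<in> sa_contractions n \<Longrightarrow> defect n a \<in> ops n n"
  unfolding defect_def by (intro ops_diff proj_in_ops ops_comp[of _ n n] sa_contractions_ops)

text \<open>The square of this matrix is diagonal, since \<open>a\<close> commutes with \<open>d = 1 - a\<^sup>2\<close>, and both diagonal
  entries are \<open>a\<^sup>2 + d\<^sup>2 = 1 - a d a \<le> 1\<close>. The entry \<open>d\<close> vanishes only if \<open>a\<^sup>2 = 1\<close>, so a maximal
  point consists of symmetries.\<close>

lemma defect_dilation:
  assumes u: "sum_unitary n n m u v" and a: "a \<in> sa_contractions n"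
  shows "block u v a (defect n a) (defect n a) (- a) \<in> sa_contractions m"
proof -
  let ?d = "defect n a"
  note ops = sa_contractions_ops[OF a] defect_ops[OF a]
  have sa: "a x \<bullet> y = x \<bullet> a y" for x y by (rule sa_contractions_inner[OF a])
  have d: "?d x = x - a (a x)" if "x \<in> ell2_of n" for x
    using that by (simp add: defect_def blinfun.diff_left ell2_of_iff)
  have aa: "a x \<in> ell2_of n" for x using ops(1) by (rule ops_range)
  have dsa: "?d x \<bullet> y = x \<bullet> ?d y" if "x \<in> ell2_of n" "y \<in> ell2_of n" for x y
    using that by (simp add: d inner_diff sa)
  have comm: "a (?d x) = ?d (a x)" if "x \<in> ell2_of n" for x
    using that by (simp add: d aa blinfun.diff_right)
  have contr: "(norm (a x))\<^sup>2 + (norm (?d x))\<^sup>2 \<le> (norm x)\<^sup>2" if x: "x \<in> ell2_of n" for x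
  proof -
    have "(norm (a (a x)))\<^sup>2 \<le> (norm (a x))\<^sup>2"
      using contraction_norm[OF sa_contractions_norm[OF a]] by simp
    then show ?thesis
      by (simp add: d[OF x] power2_norm_eq_inner inner_diff sa inner_commute[of "a (a x)" x])
  qed
  show ?thesis
    unfolding block_sa_contractions_iff[OF u ops(1) ops(2) ops(2) ops_uminus[OF ops(1)]]
  proof (intro conjI ballI)
    fix p q p' q' assume *: "p \<in> ell2_of n" "q \<in> ell2_of n" "p' \<in> ell2_of n" "q' \<in> ell2_of n"
    show "(a p + ?d q) \<bullet> p' + (?d p + (- a) q) \<bullet> q' = p \<bullet> (a p' + ?d q') + q \<bullet> (?d p' + (- a) q')"
      using * by (simp add: inner_add inner_diff sa dsa blinfun.minus_left)
  next
    fix p q assume *: "p \<in> ell2_of n" "q \<in> ell2_of n"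
    \<comment> \<open>the mixed terms cancel because \<open>a\<close> and \<open>?d\<close> commute\<close>
    have "a p \<bullet> ?d q = ?d p \<bullet> a q"
      using * by (metis sa comm dsa aa)
    then have "(norm (a p + ?d q))\<^sup>2 + (norm (?d p + (- a) q))\<^sup>2
        = ((norm (a p))\<^sup>2 + (norm (?d p))\<^sup>2) + ((norm (a q))\<^sup>2 + (norm (?d q))\<^sup>2)"
      by (simp add: power2_norm_eq_inner inner_add inner_diff blinfun.minus_left inner_commute)
    also have "\<dots> \<le> (norm p)\<^sup>2 + (norm q)\<^sup>2"
      by (intro add_mono contr *)
    finally show "(norm (a p + ?d q))\<^sup>2 + (norm (?d p + (- a) q))\<^sup>2 \<le> (norm p)\<^sup>2 + (norm q)\<^sup>2" .
  qed
qed

theorem maximal_nc_square_iff: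
  assumes n: "n \<in> levels"
  shows "maximal nc_square n (a, b) \<longleftrightarrow> reflection n a \<and> reflection n b"
proof
  assume max: "maximal nc_square n (a, b)"
  then have ab: "a \<in> sa_contractions n" "b \<in> sa_contractions n"
    by (simp_all add: maximal_def nc_square_eq)
  have nn: "n + n \<in> levels"
    using n by (simp add: levels_def) (metis add_increasing2 zero_le)
  let ?d = "(defect n a, defect n b)"
  note su = sum_unitary_interleave[of n]
  have "block2 (even_shift o\<^sub>L proj n) (odd_shift o\<^sub>L proj n) (a, b) ?d ?d (- a, - b) \<in> nc_square (n + n)"
    using defect_dilation[OF su] ab by (simp add: block2_def nc_square_eq)
  moreover have "?d \<in> ops n n \<times> ops n n" "(- a, - b) \<in> ops n n \<times> ops n n"
    using ab by (auto intro: defect_ops ops_uminus sa_contractions_ops)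
  ultimately have "?d = 0"
    using max n nn su unfolding maximal_def by blast
  then have "defect n a = 0" "defect n b = 0" by (simp_all add: zero_prod_def)
  then have "a (a x) = x" "b (b x) = x" if "x \<in> ell2_of n" for x
    using that by (auto simp: defect_def ell2_of_iff blinfun.diff_left
        dest!: arg_cong[where f = "\<lambda>f. blinfun_apply f x"])
  then show "reflection n a \<and> reflection n b" using ab by (simp add: reflection_def)
next
  assume r: "reflection n a \<and> reflection n b"
  show "maximal nc_square n (a, b)"
    unfolding maximal_def
  proof (intro conjI ballI allI impI)
    show "(a, b) \<in> nc_square n" using r by (simp add: reflection_def nc_square_eq)
  next
    fix k m u v z12 z21 z22
    assume *: "sum_unitary n k m u v \<and>
      z12 \<in> ops k n \<times> ops k n \<and> z21 \<in> ops n k \<times> ops n k \<and> z22 \<in> ops k k \<times> ops k k \<and>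
      block2 u v (a, b) z12 z21 z22 \<in> nc_square m"
    then have "block u v a (fst z12) (fst z21) (fst z22) \<in> sa_contractions m"
      "block u v b (snd z12) (snd z21) (snd z22) \<in> sa_contractions m"
      by (simp_all add: block2_def nc_square_eq)
    with * r reflection_dilation_trivial[of n k m u v a "fst z12" "fst z21" "fst z22"]
      reflection_dilation_trivial[of n k m u v b "snd z12" "snd z21" "snd z22"]
    show "z12 = 0" "z21 = 0" "z22 \<in> nc_square k"
      by (auto simp: prod_eq_iff mem_Times_iff nc_square_eq)
  qed
qed

section \<open>Pure pairs of symmetries have level at most two\<close>

text \<open>Sums of two terms, with the index set freed of vanishing terms: purity only speaks of families of
  nonzero coefficients.\<close>

lemma op_has_sum_two:
  fixes F :: "nat \<Rightarrow> op" and T :: op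
  assumes J: "J \<subseteq> {0, 1}" and 0: "\<And>j. j \<in> {0, 1} - J \<Longrightarrow> F j = 0"
    and T: "\<And>v. v \<in> ell2_of n \<Longrightarrow> F 0 v + F 1 v = T v"
  shows "op_has_sum n F J T"
  unfolding op_has_sum_def
proof
  fix v assume v: "v \<in> ell2_of n"
  have "finite J" using J by (rule finite_subset) simp
  then have "((\<lambda>j. F j v) has_sum (\<Sum>j\<in>J. F j v)) J" by (rule has_sum_finite)
  also have "(\<Sum>j\<in>J. F j v) = (\<Sum>j\<in>{0, 1}. F j v)"
    by (rule sum.mono_neutral_left) (use J 0 in auto)
  also have "\<dots> = T v" using T[OF v] by simp
  finally show "((\<lambda>j. F j v) has_sum T v) J" .
qed

lemma compress_apply: "compress g (y, z) = (adj g o\<^sub>L y o\<^sub>L g, adj g o\<^sub>L z o\<^sub>L g)"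
  by (simp add: compress_def Let_def)

text \<open>The form in which purity is exploited. A coefficient that vanishes is covered by \<open>r = 0\<close>.\<close>

lemma pure_two_terms:
  assumes pure: "pure K n (a, b)" and n: "n \<in> levels"
    and g: "g0 \<in> ops n n" "g1 \<in> ops n n"
    and y: "(y0, z0) \<in> K n" "(y1, z1) \<in> K n"
    and one: "\<And>v. v \<in> ell2_of n \<Longrightarrow> adj g0 (g0 v) + adj g1 (g1 v) = v"
    and a: "\<And>v. v \<in> ell2_of n \<Longrightarrow> adj g0 (y0 (g0 v)) + adj g1 (y1 (g1 v)) = a v"
    and b: "\<And>v. v \<in> ell2_of n \<Longrightarrow> adj g0 (z0 (g0 v)) + adj g1 (z1 (g1 v)) = b v"
  obtains r where "\<And>v. v \<in> ell2_of n \<Longrightarrow> norm (g0 v) = r * norm v"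
proof (cases "g0 = 0")
  case True
  then show thesis using that[of 0] by simp
next
  case False
  define \<gamma> where "\<gamma> j = (if j = (0::nat) then g0 else g1)" for j
  define y where "y j = (if j = (0::nat) then (y0, z0) else (y1, z1))" for j
  define J where "J = {j \<in> {0, 1}. \<gamma> j \<noteq> 0}"
  have J: "J \<subseteq> {0, 1}" "\<And>j. j \<in> {0, 1} - J \<Longrightarrow> \<gamma> j = 0" and fin: "finite J"
    by (auto simp: J_def)
  have 1: "op_has_sum n (\<lambda>j. adj (\<gamma> j) o\<^sub>L \<gamma> j) J id_blinfun"
    using J(2) one by (intro op_has_sum_two[OF J(1)]) (auto simp: \<gamma>_def)
  have 2: "op_has_sum n (\<lambda>j. fst (compress (\<gamma> j) (y j))) J (fst (a, b))"
    using J(2) a by (intro op_has_sum_two[OF J(1)]) (auto simp: \<gamma>_def y_def compress_apply)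
  have 3: "op_has_sum n (\<lambda>j. snd (compress (\<gamma> j) (y j))) J (snd (a, b))"
    using J(2) b by (intro op_has_sum_two[OF J(1)]) (auto simp: \<gamma>_def y_def compress_apply)
  have 4: "\<forall>j\<in>J. n \<in> levels \<and> y j \<in> K n \<and> \<gamma> j \<in> ops n n \<and> \<gamma> j \<noteq> 0"
    using n g y by (auto simp: J_def \<gamma>_def y_def)
  have 5: "bounded (\<gamma> ` J)" using fin by (simp add: finite_imp_bounded)
  have "0 \<in> J" using False by (simp add: J_def \<gamma>_def)
  moreover have "\<forall>j\<in>J. \<exists>c \<nu>. isometry n n \<nu> \<and> (\<forall>v. \<gamma> j v = c *\<^sub>C \<nu> v) \<and> compress \<nu> (y j) = (a, b)"
    using pure 1 2 3 4 5 unfolding pure_def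
    by (elim conjE allE[of _ J] allE[of _ "\<lambda>_. n"] allE[of _ y] allE[of _ \<gamma>]) blast
  ultimately obtain c \<nu> where \<nu>: "isometry n n \<nu>" and c: "\<forall>v. \<gamma> 0 v = c *\<^sub>C \<nu> v"
    by blast
  have "norm (g0 v) = cmod c * norm v" if "v \<in> ell2_of n" for v
    using c \<nu> that by (simp add: \<gamma>_def isometry_def norm_scaleC)
  then show thesis by (rule that)
qed

lemma reflection_conjugate:
  assumes "reflection n a" "reflection n b"
  shows "reflection n (a o\<^sub>L b o\<^sub>L a)"
proof (rule reflectionI)
  have sa: "a \<in> sa_contractions n" "b \<in> sa_contractions n"
    using assms by (simp_all add: reflection_def)
  note ops = sa[THEN sa_contractions_ops]
  show aba: "a o\<^sub>L b o\<^sub>L a \<in> ops n n" using ops by (intro ops_comp)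
  show "adj (a o\<^sub>L b o\<^sub>L a) = a o\<^sub>L b o\<^sub>L a"
    by (rule adj_eqI[OF aba aba]) (simp add: sa[THEN sa_contractions_inner])
  show "(a o\<^sub>L b o\<^sub>L a) ((a o\<^sub>L b o\<^sub>L a) x) = x" if "x \<in> ell2_of n" for x
    using assms that by (simp add: reflection_def ops[THEN ops_range])
qed

lemma sa_contractions_uminus:
  assumes "a \<in> sa_contractions n"
  shows "- a \<in> sa_contractions n"
  using assms unfolding sa_contractions_iff[OF sa_contractions_ops[OF assms]]
    sa_contractions_iff[OF ops_uminus[OF sa_contractions_ops[OF assms]]]
  by (simp add: blinfun.minus_left)

text \<open>The coefficients \<open>(1 \<plusminus> a b) / 2\<close> and the points \<open>\<plusminus>(a b a, a)\<close> form a decomposition of \<open>(a, b)\<close>;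
  for instance, the first coordinate of the sum is \<open>(b a a b a + a b a a b) / 2 = a\<close>. By purity
  \<open>\<parallel>v + a b v\<parallel>\<close> is a fixed multiple of \<open>\<parallel>v\<parallel>\<close>. This says that the quadratic form of \<open>a b + b a\<close> is a
  multiple of \<open>\<parallel>v\<parallel>\<^sup>2\<close>, and polarization gives the operator identity.\<close>

lemma pure_reflections_anticommute_scalar:
  assumes n: "n \<in> levels" and pure: "pure nc_square n (a, b)"
    and a: "reflection n a" and b: "reflection n b"
  obtains c where "\<And>v. v \<in> ell2_of n \<Longrightarrow> a (b v) + b (a v) = (2 * c) *\<^sub>R v"
proof -
  have sa: "a \<in> sa_contractions n" "b \<in> sa_contractions n"
    using a b by (simp_all add: reflection_def)
  note ops = sa[THEN sa_contractions_ops]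
  have inv: "a (a v) = v" "b (b v) = v" if "v \<in> ell2_of n" for v
    using a b that by (simp_all add: reflection_def)
  note sym = sa[THEN sa_contractions_inner]
  note range = ops[THEN ops_range]
  let ?g0 = "(1/2) *\<^sub>R (proj n + (a o\<^sub>L b))" and ?g1 = "(1/2) *\<^sub>R (proj n - (a o\<^sub>L b))"
  let ?h0 = "(1/2) *\<^sub>R (proj n + (b o\<^sub>L a))" and ?h1 = "(1/2) *\<^sub>R (proj n - (b o\<^sub>L a))"
  have g: "?g0 \<in> ops n n" "?g1 \<in> ops n n" and h: "?h0 \<in> ops n n" "?h1 \<in> ops n n"
    by (intro ops_scaleR ops_add ops_diff proj_in_ops ops_comp[of _ n n] ops)+
  have app: "?g0 v = (1/2) *\<^sub>R (v + a (b v))" "?g1 v = (1/2) *\<^sub>R (v - a (b v))"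
    "?h0 v = (1/2) *\<^sub>R (v + b (a v))" "?h1 v = (1/2) *\<^sub>R (v - b (a v))" if "v \<in> ell2_of n" for v
    using that by (simp_all add: blinfun.add_left blinfun.diff_left blinfun.scaleR_left ell2_of_iff)
  have adj: "adj ?g0 = ?h0" "adj ?g1 = ?h1"
    by (rule adj_eqI[OF g(1) h(1)] adj_eqI[OF g(2) h(2)];
        simp only: app inner_add inner_diff inner_scaleR_left inner_scaleR_right sym)+
  let ?aba = "a o\<^sub>L b o\<^sub>L a"
  have y: "(?aba, a) \<in> nc_square n" "(- ?aba, - a) \<in> nc_square n"
    using sa(1) reflection_conjugate[OF a b] sa_contractions_uminus
    by (simp_all add: nc_square_eq reflection_def)
  note mem = ell2_of_add ell2_of_diff ell2_of_uminus ell2_of_scaleR range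
  note lin = blinfun.add_right blinfun.diff_right blinfun.scaleR_right blinfun.minus_left blinfun.minus_right
  have half: "(1/2) *\<^sub>R x + (1/2) *\<^sub>R x = x" for x :: ell2
    by (simp flip: scaleR_add_left)
  have quarter: "(1/4) *\<^sub>R x + (1/4) *\<^sub>R x = (1/2) *\<^sub>R x" for x :: ell2
    by (simp flip: scaleR_add_left)
  obtain r where r: "\<And>v. v \<in> ell2_of n \<Longrightarrow> norm (?g0 v) = r * norm v"
  proof (rule pure_two_terms[OF pure n g y])
    fix v assume v: "v \<in> ell2_of n"
    show "adj ?g0 (?g0 v) + adj ?g1 (?g1 v) = v"
      unfolding adj by (simp only: app mem v blinfun_apply_blinfun_compose blinfun.minus_left)
        (simp add: lin inv mem v algebra_simps half quarter)
    show "adj ?g0 (?aba (?g0 v)) + adj ?g1 ((- ?aba) (?g1 v)) = a v"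
      unfolding adj by (simp only: app mem v blinfun_apply_blinfun_compose blinfun.minus_left)
        (simp add: lin inv mem v algebra_simps half quarter)
    show "adj ?g0 (a (?g0 v)) + adj ?g1 ((- a) (?g1 v)) = b v"
      unfolding adj by (simp only: app mem v blinfun_apply_blinfun_compose blinfun.minus_left)
        (simp add: lin inv mem v algebra_simps half quarter)
  qed blast
  define c where "c = 2 * r\<^sup>2 - 1"
  have quad: "a v \<bullet> b v = c * (v \<bullet> v)" if v: "v \<in> ell2_of n" for v
  proof -
    have "a (b v) \<bullet> a (b v) = v \<bullet> v"
      using v by (simp add: sym range inv)
    moreover have "a (b v) \<bullet> v = a v \<bullet> b v" by (simp add: sym inner_commute)
    moreover have "(norm ((1/2) *\<^sub>R (v + a (b v))))\<^sup>2 = r\<^sup>2 * (v \<bullet> v)"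
      using r[OF v] by (simp add: app v power_mult_distrib power2_norm_eq_inner)
    ultimately show ?thesis
      by (simp add: c_def power_divide power2_norm_eq_inner inner_add inner_commute algebra_simps)
  qed
  have "a (b w) + b (a w) = (2 * c) *\<^sub>R w" if w: "w \<in> ell2_of n" for w
  proof -
    define d where "d = a (b w) + b (a w) - (2 * c) *\<^sub>R w"
    \<comment> \<open>polarize the quadratic identity and test it on the difference \<open>d\<close> itself\<close>
    have d: "d \<in> ell2_of n" unfolding d_def by (intro mem w)
    have "w \<bullet> a (b d) = d \<bullet> b (a w)"
      by (metis sym inner_commute)
    then have "d \<bullet> (a (b w) + b (a w)) = 2 * c * (d \<bullet> w)"
      using quad[OF ell2_of_add[OF d w]] quad[OF d] quad[OF w]
      by (simp add: lin inner_add sym algebra_simps inner_commute)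
    then have "d \<bullet> (a (b w) + b (a w) - (2 * c) *\<^sub>R w) = 0" by (simp add: inner_diff)
    then have "d \<bullet> d = 0" unfolding d_def[symmetric] .
    then show ?thesis by (simp add: d_def)
  qed
  then show thesis by (rule that)
qed

text \<open>Irreducibility of pure points: if \<open>p\<close> reduces \<open>(a, b)\<close>, then
  \<open>(a, b) = p (a, b) p + (1 - p) (a, b) (1 - p)\<close>, so \<open>p\<close> is a multiple of an isometry, and a nonzero projection
  with this property is the identity.\<close>

lemma pure_reducing_projection_trivial:
  assumes n: "n \<in> levels" and pure: "pure K n (a, b)"
    and ab: "a \<in> ops n n" "b \<in> ops n n"
    and p: "p \<in> ops n n" "adj p = p" "\<And>x. p (p x) = p x"
    and comm: "\<And>x. a (p x) = p (a x)" "\<And>x. b (p x) = p (b x)"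
    and e: "e \<noteq> 0" "p e = e" and v: "v \<in> ell2_of n"
  shows "p v = v"
proof -
  let ?q = "proj n - p"
  have q: "?q \<in> ops n n" using p(1) by (intro ops_diff proj_in_ops)
  have sym: "p x \<bullet> y = x \<bullet> p y" for x y using ops_inner_adj[OF p(1)] p(2) by simp
  have adj_q: "adj ?q = ?q"
    by (rule adj_eqI[OF q q]) (simp add: blinfun.diff_left inner_diff sym inner_proj)
  have mem: "(a, b) \<in> K n" using pure by (simp add: pure_def)
  note rules = p(2,3) adj_q comm ops_proj_left[OF p(1)] ops_proj_right[OF p(1)]
    ops_proj_left[OF ab(1)] ops_proj_left[OF ab(2)] ops_proj_right[OF ab(1)] ops_proj_right[OF ab(2)]
    blinfun.diff_left blinfun.diff_right ell2_of_iff
  obtain r where r: "\<And>v. v \<in> ell2_of n \<Longrightarrow> norm (p v) = r * norm v"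
    by (rule pure_two_terms[OF pure n p(1) q mem mem]; ((simp add: rules; fail) | blast))
  have "e \<in> ell2_of n" using ops_proj_left[OF p(1), of e] e(2) by (simp add: ell2_of_iff)
  then have "r = 1" using r[of e] e by simp
  then have nrm: "p v \<bullet> p v = v \<bullet> v" using r[OF v] by (simp add: norm_eq_sqrt_inner)
  have "(v - p v) \<bullet> (v - p v) = v \<bullet> v - p v \<bullet> p v"
    using sym[of v "p v"] sym[of v v] p(3)[of v] by (simp add: inner_diff inner_commute)
  then show ?thesis using nrm by simp
qed

lemma reflection_eigenvector:
  assumes n: "n \<in> levels" and a: "reflection n a"
  obtains e \<epsilon> where "e \<in> ell2_of n" "norm e = 1" "a e = \<epsilon> *\<^sub>R e" "\<epsilon> * \<epsilon> = 1"
proof -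
  define w where "w = basis_vec 0"
  have w: "w \<in> ell2_of n" "w \<noteq> 0"
  proof -
    have "enat 0 < n" using n by (cases n) (auto simp: levels_def one_enat_def)
    then show "w \<in> ell2_of n" by (auto simp: ell2_of_def w_def)
    have "coord w 0 \<noteq> coord 0 0" by (simp add: w_def)
    then show "w \<noteq> 0" by metis
  qed
  have aw: "a w \<in> ell2_of n" "a (a w) = w"
    using a w by (auto simp: reflection_def intro: ops_range[OF sa_contractions_ops])
  \<comment> \<open>the components of \<open>w\<close> in the two eigenspaces cannot both vanish\<close>
  have "\<exists>\<epsilon>. \<epsilon> * \<epsilon> = 1 \<and> w + \<epsilon> *\<^sub>R a w \<noteq> 0"
  proof (rule ccontr)
    assume "\<nexists>\<epsilon>. \<epsilon> * \<epsilon> = 1 \<and> w + \<epsilon> *\<^sub>R a w \<noteq> 0"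
    then have "w + 1 *\<^sub>R a w = 0" "w + (-1) *\<^sub>R a w = 0" by (metis mult_1 mult_minus1 minus_minus)+
    then have "w + w = 0" by simp
    then show False using w(2) by (metis scaleR_2 scaleR_eq_0_iff zero_neq_numeral)
  qed
  then obtain \<epsilon> where \<epsilon>: "\<epsilon> * \<epsilon> = 1" and f: "w + \<epsilon> *\<^sub>R a w \<noteq> 0" by blast
  define f where "f = w + \<epsilon> *\<^sub>R a w"
  have "a f = \<epsilon> *\<^sub>R f"
    using \<epsilon> by (simp add: f_def blinfun.add_right blinfun.scaleR_right aw scaleR_add_right)
  then have "a (f /\<^sub>R norm f) = \<epsilon> *\<^sub>R (f /\<^sub>R norm f)" by (simp add: blinfun.scaleR_right mult.commute)
  moreover have "f /\<^sub>R norm f \<in> ell2_of n"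
    unfolding f_def by (intro ell2_of_scaleR ell2_of_add w aw)
  ultimately show thesis
    using that[of "f /\<^sub>R norm f" \<epsilon>] \<epsilon> f by (simp add: f_def)
qed

text \<open>Let \<open>a b + b a = 2 d\<close> and let \<open>e\<close> be a unit vector with \<open>a e = \<epsilon> e\<close>. The component \<open>f\<close> of \<open>b e\<close>
  orthogonal to \<open>e\<close> lies in the other eigenspace of \<open>a\<close>, and in the basis of \<open>e\<close> and the normalized
  vector \<open>g\<close> the symmetry \<open>b\<close> has rows \<open>(c, s)\<close> and \<open>(s, -c)\<close> with \<open>c\<^sup>2 + s\<^sup>2 = 1\<close>. The projection
  \<open>p\<close> onto the span of \<open>e\<close> and \<open>g\<close> therefore reduces the pair, so \<open>p = 1\<close>. At level 3 or higher,
  three diagonal entries of \<open>p\<close> would add up to 3, while its trace is at most 2.\<close>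

lemma pure_reflections_level_le_2:
  assumes n: "n \<in> levels" and pure: "pure nc_square n (a, b)"
    and a: "reflection n a" and b: "reflection n b"
  shows "n < 3"
proof (rule ccontr)
  assume "\<not> n < 3"
  then have n3: "enat k < n" if "k < 3" for k
    using that by (cases n) (auto simp: numeral_eq_enat)
  have sa: "a \<in> sa_contractions n" "b \<in> sa_contractions n"
    using a b by (simp_all add: reflection_def)
  note ops = sa[THEN sa_contractions_ops]
  note sym = sa[THEN sa_contractions_inner] and csym = sa[THEN cinner_sa_contraction]
  obtain d where d: "\<And>v. v \<in> ell2_of n \<Longrightarrow> a (b v) + b (a v) = (2 * d) *\<^sub>R v"
    by (rule pure_reflections_anticommute_scalar[OF n pure a b]) blast
  obtain e \<epsilon> where e: "e \<in> ell2_of n" "norm e = 1" and ae: "a e = \<epsilon> *\<^sub>R e" and \<epsilon>: "\<epsilon> * \<epsilon> = 1"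
    by (rule reflection_eigenvector[OF n a]) blast
  define c where "c = \<epsilon> * d"
  define f where "f = b e - c *\<^sub>R e"
  define s where "s = sqrt (1 - c\<^sup>2)"
  \<comment> \<open>if \<open>s = 0\<close>, then \<open>g = 0\<close> as division by 0 gives 0, and \<open>p\<close> below has rank one\<close>
  define g where "g = f /\<^sub>R s"
  have bb: "b (b e) = e" using b e by (simp add: reflection_def)
  have f_mem: "f \<in> ell2_of n"
    unfolding f_def by (intro ell2_of_diff ell2_of_scaleR e ops_range[OF ops(2)])
  have abe: "a (b e) = (2 * d) *\<^sub>R e - \<epsilon> *\<^sub>R b e"
    using d[OF e(1)] by (simp add: ae blinfun.scaleR_right algebra_simps)
  have af: "a f = - \<epsilon> *\<^sub>R f"
  proof -
    have "\<epsilon> * c = d" using \<epsilon> by (simp add: c_def flip: mult.assoc)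
    then have "2 * d - c * \<epsilon> = \<epsilon> * c" by (simp add: mult.commute)
    moreover have "a f = (2 * d - c * \<epsilon>) *\<^sub>R e - \<epsilon> *\<^sub>R b e"
      by (simp add: f_def blinfun.diff_right blinfun.scaleR_right abe ae scaleR_diff_left)
    ultimately show ?thesis by (simp add: f_def scaleR_diff_right)
  qed
  have eps: "\<epsilon> \<noteq> 0" using \<epsilon> by auto
  have orth: "cinner e f = 0" "cinner f e = 0"
  proof -
    have "cinner (a e) f = cinner e (a f)" "cinner (a f) e = cinner f (a e)" by (rule csym)+
    then show "cinner e f = 0" "cinner f e = 0"
      using eps by (auto simp: ae af cinner_uminus_left cinner_uminus_right cinner_scaleR_left cinner_scaleR_right)
  qed
  have ef: "e \<bullet> f = 0" "f \<bullet> e = 0"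
    using orth by (simp_all add: cinner_eq_Complex_inner complex_eq_iff)
  have ee: "e \<bullet> e = 1" using e(2) by (simp add: norm_eq_sqrt_inner)
  have be: "b e = c *\<^sub>R e + f" by (simp add: f_def)
  have ff: "f \<bullet> f = 1 - c\<^sup>2"
  proof -
    have "b e \<bullet> b e = 1" using sym(2)[of e "b e"] bb ee by simp
    then show ?thesis by (simp add: be inner_add ef ee power2_eq_square)
  qed
  have "0 \<le> 1 - c\<^sup>2" using inner_ge_zero[of f] ff by simp
  then have s: "s * s = 1 - c\<^sup>2" by (simp add: s_def)
  have sg: "s *\<^sub>R g = f"
    using ff s by (cases "s = 0") (auto simp: g_def)
  have bg: "b g = s *\<^sub>R e - c *\<^sub>R g"
  proof -
    have "b f = (s * s) *\<^sub>R e - c *\<^sub>R f"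
    proof -
      have "b f = e - c *\<^sub>R b e"
        unfolding f_def by (simp only: blinfun.diff_right blinfun.scaleR_right bb)
      then show ?thesis
        unfolding be s by (simp add: power2_eq_square algebra_simps)
    qed
    moreover have "s *\<^sub>R b g = b f"
      by (simp add: sg flip: blinfun.scaleR_right)
    moreover have "s *\<^sub>R (s *\<^sub>R e - c *\<^sub>R g) = (s * s) *\<^sub>R e - c *\<^sub>R s *\<^sub>R g"
      by (simp add: scaleR_diff_right mult.commute)
    ultimately have "s *\<^sub>R b g = s *\<^sub>R (s *\<^sub>R e - c *\<^sub>R g)"
      by (simp only: sg)
    then show ?thesis
      by (cases "s = 0") (simp_all add: g_def)
  qed
  have g_mem: "g \<in> ell2_of n" unfolding g_def by (intro ell2_of_scaleR f_mem)
  have gg: "cinner g g *\<^sub>C g = g" "norm g \<le> 1"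
  proof -
    have "norm g = 1" if "s \<noteq> 0"
    proof -
      have "g \<bullet> g = 1" using that ff s[symmetric] by (simp add: g_def field_simps)
      then show ?thesis by (simp add: norm_eq_sqrt_inner)
    qed
    moreover have "g = 0" if "s = 0" using that by (simp add: g_def)
    ultimately consider "g = 0" | "norm g = 1" by blast
    then have "cinner g g *\<^sub>C g = g \<and> norm g \<le> 1" by cases (simp_all add: cinner_self)
    then show "cinner g g *\<^sub>C g = g" "norm g \<le> 1" by simp_all
  qed
  have eg: "cinner e g = 0" "cinner g e = 0"
    by (simp_all add: g_def cinner_scaleR_left cinner_scaleR_right orth)
  define p where "p = rank_one e e + rank_one g g"
  have p_apply: "p x = cinner x e *\<^sub>C e + cinner x g *\<^sub>C g" for x
    by (simp add: p_def blinfun.add_left)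
  have p_ops: "p \<in> ops n n" unfolding p_def by (intro ops_add rank_one_ops e g_mem)
  have p_adj: "adj p = p"
    by (rule adj_eqI[OF p_ops p_ops]) (simp add: p_def blinfun.add_left inner_add inner_rank_one del: rank_one_apply)
  have pe: "p e = e" "p g = g"
    by (simp add: p_apply eg cinner_self e) (simp add: p_apply eg gg)
  have p_lin: "p (k *\<^sub>C x) = k *\<^sub>C p x" for k x
    using ops_complex_linear[OF p_ops] by (simp add: complex_linear_def)
  have pp: "p (p x) = p x" for x
    by (simp add: p_apply[of x] blinfun.add_right p_lin pe)
  have ag: "a g = - \<epsilon> *\<^sub>R g"
    by (simp add: g_def blinfun.scaleR_right af mult.commute)
  have ab_lin: "a (k *\<^sub>C x) = k *\<^sub>C a x" "b (k *\<^sub>C x) = k *\<^sub>C b x" for k x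
    using ops[THEN ops_complex_linear] by (simp_all add: complex_linear_def)
  have pa: "a (p x) = p (a x)" for x
    by (rule ell2_eqI) (simp add: p_apply blinfun.add_right ab_lin csym ae ag
        cinner_scaleR_right cinner_uminus_right algebra_simps)
  have be': "b e = c *\<^sub>R e + s *\<^sub>R g" by (simp add: be sg)
  have pb: "b (p x) = p (b x)" for x
    by (rule ell2_eqI) (simp add: p_apply blinfun.add_right ab_lin csym be' bg cinner_scaleR_right
        cinner_add_right cinner_diff_right algebra_simps)
  have "e \<noteq> 0" using e(2) by auto
  \<comment> \<open>the diagonal entries of \<open>p\<close>\<close>
  have "coord (p (basis_vec k)) k = (cmod (coord e k))\<^sup>2 + (cmod (coord g k))\<^sup>2" for k
    by (simp add: p_apply cinner_basis_vec mult.commute flip: complex_norm_square)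
  moreover have "p (basis_vec k) = basis_vec k" if "k < 3" for k
    by (rule pure_reducing_projection_trivial[OF n pure ops p_ops p_adj pp pa pb \<open>e \<noteq> 0\<close> pe(1)])
      (use n3[OF that] in \<open>auto simp: ell2_of_def\<close>)
  ultimately have "(cmod (coord e k))\<^sup>2 + (cmod (coord g k))\<^sup>2 = 1" if "k < 3" for k
    using that by (metis (mono_tags) coord_basis_vec of_real_eq_1_iff of_real_add)
  then have "(\<Sum>k<3. (cmod (coord e k))\<^sup>2 + (cmod (coord g k))\<^sup>2) = 3" by simp
  moreover have "(\<Sum>k<3. (cmod (coord e k))\<^sup>2 + (cmod (coord g k))\<^sup>2) \<le> (norm e)\<^sup>2 + (norm g)\<^sup>2"
    using sum_le_suminf[of "\<lambda>k. (cmod (coord e k))\<^sup>2 + (cmod (coord g k))\<^sup>2" "{..<3}"]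
      sums_add[OF norm_sums[of e] norm_sums[of g]]
    by (simp add: sums_iff)
  ultimately show False
    using e(2) gg(2) power_le_one[of "norm g" 2] by simp
qed

section \<open>Irreducible pairs of symmetries are pure\<close>

text \<open>Weak form of a noncommutative convex combination, where only scalar families have to be summed.\<close>

lemma has_sum_compression_inner:
  assumes s: "op_has_sum n (\<lambda>j. adj (\<gamma> j) o\<^sub>L y j o\<^sub>L \<gamma> j) J T"
    and \<gamma>: "\<And>j. j \<in> J \<Longrightarrow> \<gamma> j \<in> ops n (m j)" and v: "v \<in> ell2_of n"
  shows "((\<lambda>j. y j (\<gamma> j v) \<bullet> \<gamma> j w) has_sum (T v \<bullet> w)) J"
proof -
  have "((\<lambda>j. (adj (\<gamma> j) o\<^sub>L y j o\<^sub>L \<gamma> j) v) has_sum T v) J"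
    using s v by (simp add: op_has_sum_def)
  from has_sum_bounded_linear[OF bounded_linear_inner_left[of w] this]
  show ?thesis
    by (rule has_sum_cong[THEN iffD1, rotated])
      (simp add: inner_commute[of _ w] ops_inner_adj[OF \<gamma>, symmetric] inner_commute)
qed

text \<open>Equality in Cauchy--Schwarz: expanding, and using that \<open>y\<^sub>j\<close> is a contraction,
  \<open>\<Sum>\<^sub>j \<parallel>y\<^sub>j \<gamma>\<^sub>j v - \<gamma>\<^sub>j a v\<parallel>\<^sup>2 \<le> \<parallel>v\<parallel>\<^sup>2 - 2 \<parallel>a v\<parallel>\<^sup>2 + \<parallel>a v\<parallel>\<^sup>2 = 0\<close>.\<close>

lemma compression_to_reflection_intertwines:
  assumes a: "reflection n a"
    and one: "op_has_sum n (\<lambda>j. adj (\<gamma> j) o\<^sub>L \<gamma> j) J id_blinfun"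
    and s: "op_has_sum n (\<lambda>j. adj (\<gamma> j) o\<^sub>L y j o\<^sub>L \<gamma> j) J a"
    and \<gamma>: "\<And>j. j \<in> J \<Longrightarrow> \<gamma> j \<in> ops n (m j)"
    and y: "\<And>j. j \<in> J \<Longrightarrow> y j \<in> sa_contractions (m j)"
    and j: "j \<in> J" and v: "v \<in> ell2_of n"
  shows "y j (\<gamma> j v) = \<gamma> j (a v)"
proof -
  have a_sa: "a \<in> sa_contractions n" and aa: "a (a v) = v"
    using a v by (simp_all add: reflection_def)
  note a_ops = sa_contractions_ops[OF a_sa] and a_sym = sa_contractions_inner[OF a_sa]
  have av: "a v \<in> ell2_of n" using a_ops by (rule ops_range)
  have "op_has_sum n (\<lambda>j. adj (\<gamma> j) o\<^sub>L id_blinfun o\<^sub>L \<gamma> j) J id_blinfun"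
    using one by (simp add: op_has_sum_def)
  note unit = has_sum_compression_inner[OF this \<gamma>]
  \<comment> \<open>an upper bound for \<open>\<parallel>y\<^sub>j \<gamma>\<^sub>j v - \<gamma>\<^sub>j a v\<parallel>\<^sup>2\<close>\<close>
  let ?t = "\<lambda>j. (\<gamma> j v \<bullet> \<gamma> j v + - 2 * (y j (\<gamma> j v) \<bullet> \<gamma> j (a v))) + \<gamma> j (a v) \<bullet> \<gamma> j (a v)"
  have isom: "a v \<bullet> a v = v \<bullet> v" using a_sym[of v "a v"] aa by simp
  have "(?t has_sum ((v \<bullet> v + - 2 * (a v \<bullet> a v)) + a v \<bullet> a v)) J"
    using unit[OF _ v, of v] unit[OF _ av, of "a v"] has_sum_compression_inner[OF s \<gamma> v, of "a v"]
    by (intro has_sum_add has_sum_cmult_right) simp_all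
  then have total: "(?t has_sum 0) J" by (simp add: isom)
  have bound: "(norm (y i (\<gamma> i v) - \<gamma> i (a v)))\<^sup>2 \<le> ?t i" if "i \<in> J" for i
  proof -
    have "(norm (y i (\<gamma> i v)))\<^sup>2 \<le> (norm (\<gamma> i v))\<^sup>2"
      using contraction_norm[OF sa_contractions_norm[OF y[OF that]]] by simp
    then show ?thesis by (simp add: power2_norm_eq_inner inner_diff inner_commute)
  qed
  have "?t j = 0"
  proof (rule nonneg_has_sum_le_0D[OF total _ _ j])
    show "0 \<le> ?t i" if "i \<in> J" for i
      using bound[OF that] zero_le_power2 order_trans by blast
  qed simp
  then show ?thesis using bound[OF j] by simp
qed

text \<open>That is, \<open>\<nu>\<^sup>* \<nu> = 1\<close>, by polarization of \<open>\<parallel>\<nu> x\<parallel> = \<parallel>x\<parallel>\<close>.\<close>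

lemma isometry_adj_cancel:
  assumes \<nu>: "isometry n m \<nu>" and x: "x \<in> ell2_of n"
  shows "adj \<nu> (\<nu> x) = x"
proof -
  have nrm: "norm (\<nu> z) = norm z" if "z \<in> ell2_of n" for z
    using \<nu> that by (simp add: isometry_def)
  have ops: "\<nu> \<in> ops n m" using \<nu> by (simp add: isometry_def)
  have inner: "\<nu> z \<bullet> \<nu> x = z \<bullet> x" if z: "z \<in> ell2_of n" for z
    using nrm[OF ell2_of_add[OF z x]] nrm[OF z] nrm[OF x]
    by (simp add: norm_eq_sqrt_inner blinfun.add_right inner_add inner_commute)
  have "z \<bullet> adj \<nu> (\<nu> x) = z \<bullet> x" for z
  proof -
    have "z \<bullet> adj \<nu> (\<nu> x) = \<nu> (proj n z) \<bullet> \<nu> x"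
      by (simp add: ops_inner_adj[OF ops, symmetric] ops_proj_right[OF ops])
    also have "\<dots> = z \<bullet> x"
      using inner[of "proj n z"] x by (simp add: ell2_of_iff inner_proj)
    finally show ?thesis .
  qed
  then show ?thesis by (metis vector_eq_ldot)
qed

text \<open>The assumption \<open>irred\<close> says that \<open>\<gamma>\<^sup>* \<gamma>\<close> is a scalar whenever it commutes with \<open>a\<close> and \<open>b\<close>,
  written without adjoints. Applied to a coefficient \<open>\<gamma>\<close> of a decomposition, it yields an isometry
  \<open>\<nu> = \<gamma> / r\<close> such that \<open>y \<nu> = \<nu> (a, b)\<close>, where \<open>y\<close> is the point compressed by \<open>\<gamma>\<close>; then
  \<open>\<nu>\<^sup>* y \<nu> = \<nu>\<^sup>* \<nu> (a, b) = (a, b)\<close>.\<close>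

lemma pure_of_irreducible_reflections:
  assumes a: "reflection n a" and b: "reflection n b"
    and irred: "\<And>\<gamma> :: op. complex_linear \<gamma> \<Longrightarrow>
      (\<And>v w. v \<in> ell2_of n \<Longrightarrow> w \<in> ell2_of n \<Longrightarrow> \<gamma> (a v) \<bullet> \<gamma> w = \<gamma> v \<bullet> \<gamma> (a w)) \<Longrightarrow>
      (\<And>v w. v \<in> ell2_of n \<Longrightarrow> w \<in> ell2_of n \<Longrightarrow> \<gamma> (b v) \<bullet> \<gamma> w = \<gamma> v \<bullet> \<gamma> (b w)) \<Longrightarrow>
      \<exists>r. \<forall>v\<in>ell2_of n. norm (\<gamma> v) = r * norm v"
  shows "pure nc_square n (a, b)"
  unfolding pure_def
proof (intro conjI allI impI ballI)
  have sa: "a \<in> sa_contractions n" "b \<in> sa_contractions n"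
    using a b by (simp_all add: reflection_def)
  then show "(a, b) \<in> nc_square n" by (simp add: nc_square_eq)
  note ab_ops = sa[THEN sa_contractions_ops]
  fix J :: "nat set" and m y and \<gamma> :: "nat \<Rightarrow> op" and j
  assume *: "(\<forall>j\<in>J. m j \<in> levels \<and> y j \<in> nc_square (m j) \<and> \<gamma> j \<in> ops n (m j) \<and> \<gamma> j \<noteq> 0) \<and>
      bounded (\<gamma> ` J) \<and>
      op_has_sum n (\<lambda>j. adj (\<gamma> j) o\<^sub>L \<gamma> j) J id_blinfun \<and>
      op_has_sum n (\<lambda>j. fst (compress (\<gamma> j) (y j))) J (fst (a, b)) \<and>
      op_has_sum n (\<lambda>j. snd (compress (\<gamma> j) (y j))) J (snd (a, b))"
    and j: "j \<in> J"
  have \<gamma>: "\<gamma> i \<in> ops n (m i)" and y: "fst (y i) \<in> sa_contractions (m i)" "snd (y i) \<in> sa_contractions (m i)"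
    if "i \<in> J" for i
    using * that by (auto simp: nc_square_eq mem_Times_iff)
  have compress: "compress g z = (adj g o\<^sub>L fst z o\<^sub>L g, adj g o\<^sub>L snd z o\<^sub>L g)" for g z
    using compress_apply[of g "fst z" "snd z"] by simp
  have one: "op_has_sum n (\<lambda>j. adj (\<gamma> j) o\<^sub>L \<gamma> j) J id_blinfun"
    and sums: "op_has_sum n (\<lambda>j. adj (\<gamma> j) o\<^sub>L fst (y j) o\<^sub>L \<gamma> j) J a"
      "op_has_sum n (\<lambda>j. adj (\<gamma> j) o\<^sub>L snd (y j) o\<^sub>L \<gamma> j) J b"
    using * by (simp_all add: compress)
  have ya: "fst (y j) (\<gamma> j v) = \<gamma> j (a v)" if "v \<in> ell2_of n" for v
    by (rule compression_to_reflection_intertwines[where y = "\<lambda>j. fst (y j)", OF a one sums(1) \<gamma> y(1) j that])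
  have yb: "snd (y j) (\<gamma> j v) = \<gamma> j (b v)" if "v \<in> ell2_of n" for v
    by (rule compression_to_reflection_intertwines[where y = "\<lambda>j. snd (y j)", OF b one sums(2) \<gamma> y(2) j that])
  obtain r where r: "\<And>v. v \<in> ell2_of n \<Longrightarrow> norm (\<gamma> j v) = r * norm v"
    using irred[OF ops_complex_linear[OF \<gamma>[OF j]]] ya yb y[OF j, THEN sa_contractions_inner] by metis
  have "r > 0"
  proof (rule ccontr)
    assume "\<not> r > 0"
    then have "norm (\<gamma> j v) \<le> 0" if "v \<in> ell2_of n" for v
      using r[OF that] by (simp add: mult_nonpos_nonneg)
    then have "\<gamma> j = 0" by (intro ops_eqI[OF \<gamma>[OF j] ops_zero]) simp
    then show False using * j by blast
  qed
  define \<nu> where "\<nu> = (1 / r) *\<^sub>R \<gamma> j"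
  have \<nu>_ops: "\<nu> \<in> ops n (m j)" unfolding \<nu>_def by (intro ops_scaleR \<gamma> j)
  have \<nu>: "isometry n (m j) \<nu>"
    using \<nu>_ops \<open>r > 0\<close> r by (simp add: isometry_def \<nu>_def blinfun.scaleR_left)
  have "adj \<nu> o\<^sub>L fst (y j) o\<^sub>L \<nu> = a"
  proof (rule ops_eqI[OF _ ab_ops(1)])
    show "adj \<nu> o\<^sub>L fst (y j) o\<^sub>L \<nu> \<in> ops n n"
      by (rule ops_comp[OF \<nu>_ops ops_comp[OF sa_contractions_ops[OF y(1)[OF j]] ops_adj[OF \<nu>_ops]]])
    fix v assume v: "v \<in> ell2_of n"
    have "fst (y j) (\<nu> v) = \<nu> (a v)" by (simp add: \<nu>_def blinfun.scaleR_left blinfun.scaleR_right ya v)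
    then show "(adj \<nu> o\<^sub>L fst (y j) o\<^sub>L \<nu>) v = a v"
      by (simp add: isometry_adj_cancel[OF \<nu>] ops_range[OF ab_ops(1)])
  qed
  moreover have "adj \<nu> o\<^sub>L snd (y j) o\<^sub>L \<nu> = b"
  proof (rule ops_eqI[OF _ ab_ops(2)])
    show "adj \<nu> o\<^sub>L snd (y j) o\<^sub>L \<nu> \<in> ops n n"
      by (rule ops_comp[OF \<nu>_ops ops_comp[OF sa_contractions_ops[OF y(2)[OF j]] ops_adj[OF \<nu>_ops]]])
    fix v assume v: "v \<in> ell2_of n"
    have "snd (y j) (\<nu> v) = \<nu> (b v)" by (simp add: \<nu>_def blinfun.scaleR_left blinfun.scaleR_right yb v)
    then show "(adj \<nu> o\<^sub>L snd (y j) o\<^sub>L \<nu>) v = b v"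
      by (simp add: isometry_adj_cancel[OF \<nu>] ops_range[OF ab_ops(2)])
  qed
  ultimately have "compress \<nu> (y j) = (a, b)" by (simp add: compress)
  moreover have "\<gamma> j v = complex_of_real r *\<^sub>C \<nu> v" for v
    using \<open>r > 0\<close> by (simp add: scaleC_of_real \<nu>_def blinfun.scaleR_left)
  ultimately show "\<exists>c \<nu>. isometry n (m j) \<nu> \<and> (\<forall>v. \<gamma> j v = c *\<^sub>C \<nu> v) \<and> compress \<nu> (y j) = (a, b)"
    using \<nu> by blast
qed

section \<open>Extreme points at levels one and two\<close>

lemma extreme_point_level_1: "nc_extreme_points nc_square 1 \<noteq> {}"
proof -
  have r: "reflection 1 (proj 1)"
    by (rule reflectionI) (auto intro!: proj_in_ops adj_eqI inner_proj simp: ell2_of_iff)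
  have "pure nc_square 1 (proj 1, proj 1)"
  proof (rule pure_of_irreducible_reflections[OF r r])
    fix \<gamma> :: op assume \<gamma>: "complex_linear \<gamma>"
    have e: "norm (basis_vec 0) = 1"
      using inner_basis_vec[of "basis_vec 0" 1 0] by (simp add: norm_eq_sqrt_inner inner_complex_def)
    have "norm (\<gamma> v) = norm (\<gamma> (basis_vec 0)) * norm v" if "v \<in> ell2_of 1" for v
    proof -
      have v: "v = coord v 0 *\<^sub>C basis_vec 0"
        using that by (intro ell2_eqI) (auto simp: ell2_of_def one_enat_def)
      then have "\<gamma> v = coord v 0 *\<^sub>C \<gamma> (basis_vec 0)" using \<gamma> by (metis complex_linear_def)
      moreover have "norm v = cmod (coord v 0)" using v e norm_scaleC by (metis mult_1_right)
      ultimately show ?thesis by (simp add: norm_scaleC)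
    qed
    then show "\<exists>r. \<forall>v\<in>ell2_of 1. norm (\<gamma> v) = r * norm v" by blast
  qed
  moreover have "maximal nc_square 1 (proj 1, proj 1)"
    using r by (simp add: maximal_nc_square_iff levels_def)
  ultimately show ?thesis by (auto simp: nc_extreme_points_def)
qed

text \<open>The symmetries \<open>diag(1, -1)\<close> and the flip of the two coordinates: commuting with the first makes
  \<open>\<gamma>\<^sup>* \<gamma>\<close> diagonal, and commuting with the second makes its two diagonal entries equal.\<close>

lemma extreme_point_level_2: "nc_extreme_points nc_square 2 \<noteq> {}"
proof -
  let ?e0 = "basis_vec 0" and ?e1 = "basis_vec 1"
  define a where "a = rank_one ?e0 ?e0 - rank_one ?e1 ?e1"
  define b where "b = rank_one ?e0 ?e1 + rank_one ?e1 ?e0"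
  have lt2: "enat k < 2 \<longleftrightarrow> k = 0 \<or> k = 1" for k by (auto simp: numeral_eq_enat)
  have e_mem: "?e0 \<in> ell2_of 2" "?e1 \<in> ell2_of 2" by (auto simp: ell2_of_def numeral_eq_enat)
  have cb: "cinner x (basis_vec k) = coord x k" for x k
  proof -
    have "x \<bullet> basis_vec k = Re (coord x k)" "x \<bullet> (\<i> *\<^sub>C basis_vec k) = Im (coord x k)"
      using inner_basis_vec[of x 1 k] by (simp_all add: inner_complex_def)
    then show ?thesis by (simp add: cinner_eq_Complex_inner)
  qed
  have a: "a x = coord x 0 *\<^sub>C ?e0 - coord x 1 *\<^sub>C ?e1"
    and b: "b x = coord x 1 *\<^sub>C ?e0 + coord x 0 *\<^sub>C ?e1" for x
    by (simp_all add: a_def b_def blinfun.add_left blinfun.diff_left cb)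
  have expand: "v = coord v 0 *\<^sub>C ?e0 + coord v 1 *\<^sub>C ?e1" if "v \<in> ell2_of 2" for v
    using that by (intro ell2_eqI) (auto simp: ell2_of_def numeral_eq_enat)
  have a_ops: "a \<in> ops 2 2" and b_ops: "b \<in> ops 2 2"
    unfolding a_def b_def by (intro ops_diff ops_add rank_one_ops e_mem)+
  have ra: "reflection 2 a"
  proof (rule reflectionI[OF a_ops])
    show "adj a = a"
      by (rule adj_eqI[OF a_ops a_ops])
        (simp add: a_def blinfun.diff_left inner_diff inner_rank_one del: rank_one_apply)
    show "a (a x) = x" if "x \<in> ell2_of 2" for x
    proof -
      have "a (a x) = coord x 0 *\<^sub>C ?e0 + coord x 1 *\<^sub>C ?e1"
        by (rule ell2_eqI) (simp add: a)
      then show ?thesis by (simp only: expand[OF that, symmetric])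
    qed
  qed
  have rb: "reflection 2 b"
  proof (rule reflectionI[OF b_ops])
    show "adj b = b"
      by (rule adj_eqI[OF b_ops b_ops])
        (simp add: b_def blinfun.add_left inner_add inner_rank_one del: rank_one_apply)
    show "b (b x) = x" if "x \<in> ell2_of 2" for x
    proof -
      have "b (b x) = coord x 0 *\<^sub>C ?e0 + coord x 1 *\<^sub>C ?e1"
        by (rule ell2_eqI) (simp add: b)
      then show ?thesis by (simp only: expand[OF that, symmetric])
    qed
  qed
  have "pure nc_square 2 (a, b)"
  proof (rule pure_of_irreducible_reflections[OF ra rb])
    fix \<gamma> :: op assume lin: "complex_linear \<gamma>"
      and ga: "\<And>v w. v \<in> ell2_of 2 \<Longrightarrow> w \<in> ell2_of 2 \<Longrightarrow> \<gamma> (a v) \<bullet> \<gamma> w = \<gamma> v \<bullet> \<gamma> (a w)"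
      and gb: "\<And>v w. v \<in> ell2_of 2 \<Longrightarrow> w \<in> ell2_of 2 \<Longrightarrow> \<gamma> (b v) \<bullet> \<gamma> w = \<gamma> v \<bullet> \<gamma> (b w)"
    have "b ?e0 = ?e1" "b ?e1 = ?e0" by (simp_all add: b)
    then have g01: "norm (\<gamma> ?e1) = norm (\<gamma> ?e0)"
      using gb[OF e_mem] by (simp add: norm_eq_sqrt_inner)
    have "norm (\<gamma> v) = norm (\<gamma> ?e0) * norm v" if v: "v \<in> ell2_of 2" for v
    proof -
      define x where "x = coord v 0 *\<^sub>C ?e0"
      define z where "z = coord v 1 *\<^sub>C ?e1"
      have xz: "x \<in> ell2_of 2" "z \<in> ell2_of 2" using e_mem by (auto simp: x_def z_def ell2_of_def)
      \<comment> \<open>\<open>x\<close> and \<open>z\<close> lie in different eigenspaces of \<open>a\<close>\<close>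
      have "a x = x" "a z = - z" by (auto simp: a x_def z_def intro!: ell2_eqI)
      then have orth: "\<gamma> x \<bullet> \<gamma> z = 0" using ga[OF xz] by (simp add: blinfun.minus_right)
      have "\<gamma> v = \<gamma> x + \<gamma> z" using expand[OF v] by (metis blinfun.add_right x_def z_def)
      then have "(norm (\<gamma> v))\<^sup>2 = (norm (\<gamma> x))\<^sup>2 + (norm (\<gamma> z))\<^sup>2"
        using orth by (simp add: power2_norm_eq_inner inner_add inner_commute)
      also have "\<dots> = (norm (\<gamma> ?e0))\<^sup>2 * ((cmod (coord v 0))\<^sup>2 + (cmod (coord v 1))\<^sup>2)"
        using lin g01 by (simp add: complex_linear_def x_def z_def norm_scaleC algebra_simps)
      also have "(cmod (coord v 0))\<^sup>2 + (cmod (coord v 1))\<^sup>2 = (norm v)\<^sup>2"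
      proof -
        have "(\<lambda>k. (cmod (coord v k))\<^sup>2) sums (\<Sum>k\<in>{0, 1}. (cmod (coord v k))\<^sup>2)"
          using v by (intro sums_finite) (auto simp: ell2_of_def numeral_eq_enat)
        then show ?thesis by (simp add: norm_eqI_sums)
      qed
      finally have "(norm (\<gamma> v))\<^sup>2 = (norm (\<gamma> ?e0) * norm v)\<^sup>2" by (simp add: power_mult_distrib)
      then show ?thesis by simp
    qed
    then show "\<exists>r. \<forall>v\<in>ell2_of 2. norm (\<gamma> v) = r * norm v" by blast
  qed
  moreover have "maximal nc_square 2 (a, b)"
    using ra rb by (simp add: maximal_nc_square_iff levels_def)
  ultimately show ?thesis by (auto simp: nc_extreme_points_def)
qed

theorem corollary3p3:
  "{n \<in> levels. nc_extreme_points nc_square n \<noteq> {}} = {1, 2}"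
proof (intro equalityI subsetI)
  fix n assume "n \<in> {n \<in> levels. nc_extreme_points nc_square n \<noteq> {}}"
  then obtain a b where n: "n \<in> levels" and p: "pure nc_square n (a, b)" and m: "maximal nc_square n (a, b)"
    by (auto simp: nc_extreme_points_def)
  then have "n < 3"
    using pure_reflections_level_le_2 maximal_nc_square_iff by blast
  with n show "n \<in> {1, 2}"
    by (cases n) (auto simp: levels_def one_enat_def numeral_eq_enat)
next
  fix n :: enat assume "n \<in> {1, 2}"
  then show "n \<in> {n \<in> levels. nc_extreme_points nc_square n \<noteq> {}}"
    using extreme_point_level_1 extreme_point_level_2 by (auto simp: levels_def)
qed

end
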